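(* For any coprime positive integers $m,n$ and any integer $k\ge1$, $$q^{(km-1)(kn-1)/2+(k-1)/2}\;Q^s_{km,kn}\;=\;q^{(km-1)kn}\,\frac{[k]_q}{[km]_q}\,D_{km,kn}$$ as operators on $\Lambda$.
   Context: Let $\Lambda$ be the ring of symmetric functions in the infinite alphabet $X=x_1+x_2+\cdots$ with coefficients in $\mathbb{Q}(q)$. Plethystic notation: for a formal expression $E$, $p_k[E]$ is obtained from $E$ by replacing every variable (including $q$ and an auxiliary variable $z$) by its $k$-th power; for $F\in\Lambda$, $F[E]$ is obtained by writing $F$ as a polynomial in the power sums and substituting $p_k\mapsto p_k[E]$. Set $\Omega[E]=\exp(\sum_{k\ge1}p_k[E]/k)$, so $\Omega[-zX]=\sum_{r\ge0}(-z)^re_r[X]$. For an integer $u$ put $[u]_q=(1-q^u)/(1-q)$; set $t=1/q$, $[u]_t=(1-q^{-u})/(1-q^{-1})$, $M=(1-t)(1-q)$. For integers $u,v$ let $D_{u,v}F[X]=F[X+M[u]_q/z]\,\Omega[-z[u]_tX]\big|_{z^v}$ (coefficient of $z^v$ in the expansion in $z$). Operators $Q^s_{m,n}$ (the specialization at $t=1/q$ of the operators $Q_{m,n}$ of Burban–Schiffmann) are defined as follows, with $[A,B]=AB-BA$. For coprime positive integers $m,n$: if $m=1$, $Q^s_{1,n}=D_{1,n}$ (also $Q^s_{1,0}=D_{1,0}$); if $m\ge2$, let $(a,b)$ be the unique integer pair with $1\le a\le m-1$ and $na-mb=1$, and set $Q^s_{m,n}=\frac1M[Q^s_{m-a,n-b},Q^s_{a,b}]$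 (both $(a,b)$ and $(m-a,n-b)$ are coprime pairs with first entry $\ge1$ and second entry $\ge0$). For $k\ge2$ and coprime positive $m,n$, set $Q^s_{km,kn}=\frac1M[Q^s_{km-a,kn-b},Q^s_{a,b}]$, where $(a,b)$ is any integer pair with $1\le a\le km-1$ and $na-mb=1$ (a lattice point of the $km\times kn$ rectangle strictly below and closest to the diagonal); the resulting operator is independent of this choice. *)

theory Defs
  imports
    "HOL-Computational_Algebra.Computational_Algebra"
    "HOL-Library.Poly_Mapping"
    "HOL-Number_Theory.Cong"
begin

unbundle fps_syntax

section \<open>Formal power series in infinitely many variables\<close>

text \<open>Monomials in \<open>x\<^sub>0, x\<^sub>1, \<dots>\<close> are finitely supported exponent vectors, written additively.\<close>

type_synonym expo = "nat \<Rightarrow>\<^sub>0 nat"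

typedef 'a mps = "UNIV :: (expo \<Rightarrow> 'a) set"
  morphisms mps_coeff Abs_mps ..

setup_lifting type_definition_mps

lemma mps_eqI: "(\<And>m. mps_coeff f m = mps_coeff g m) \<Longrightarrow> f = g"
  by transfer auto

definition antidiag :: "expo \<Rightarrow> (expo \<times> expo) set" where
  "antidiag m = {(a, b). a + b = m}"

lemma finite_antidiag [simp]: "finite (antidiag m)"
proof -
  define K where "K = Poly_Mapping.keys m"
  define N where "N = Max (insert 0 (Poly_Mapping.lookup m ` K))"
  define S where "S = {f :: nat \<Rightarrow> nat. \<forall>i. (i \<in> K \<longrightarrow> f i \<in> {..N}) \<and> (i \<notin> K \<longrightarrow> f i = 0)}"
  have fin: "finite S"
    unfolding S_def by (rule finite_set_of_finite_funs) (auto simp: K_def)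
  have le: "Poly_Mapping.lookup m i \<le> N" if "i \<in> K" for i
    using that unfolding N_def K_def by (intro Max_ge) auto
  have in_S: "Poly_Mapping.lookup a \<in> S" if "\<And>i. Poly_Mapping.lookup a i \<le> Poly_Mapping.lookup m i" for a
    unfolding S_def
  proof (intro CollectI allI conjI impI)
    fix i
    show "Poly_Mapping.lookup a i \<in> {..N}" if "i \<in> K"
      using \<open>Poly_Mapping.lookup a i \<le> Poly_Mapping.lookup m i\<close> le[OF that] by auto
    show "Poly_Mapping.lookup a i = 0" if "i \<notin> K"
      using \<open>Poly_Mapping.lookup a i \<le> Poly_Mapping.lookup m i\<close> that by (simp add: K_def in_keys_iff)
  qed
  have inj: "inj Poly_Mapping.lookup"
    by (rule injI) (metis poly_mapping_eq_iff)
  have "finite (Poly_Mapping.lookup -` S)"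
    using finite_vimageI[OF fin inj] .
  moreover have "antidiag m \<subseteq> (Poly_Mapping.lookup -` S) \<times> (Poly_Mapping.lookup -` S)"
  proof
    fix p assume "p \<in> antidiag m"
    then obtain a b where p: "p = (a, b)" and m: "m = a + b"
      by (auto simp: antidiag_def)
    have "Poly_Mapping.lookup a \<in> S"
      by (rule in_S) (simp add: m lookup_add)
    moreover have "Poly_Mapping.lookup b \<in> S"
      by (rule in_S) (simp add: m lookup_add)
    ultimately show "p \<in> (Poly_Mapping.lookup -` S) \<times> (Poly_Mapping.lookup -` S)"
      by (simp add: p)
  qed
  ultimately show ?thesis
    by (meson finite_SigmaI finite_subset)
qed

instantiation mps :: (comm_ring_1) comm_ring_1
begin

lift_definition zero_mps :: "'a mps" is "\<lambda>_. 0" .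
lift_definition one_mps :: "'a mps" is "\<lambda>m. if m = 0 then 1 else 0" .
lift_definition plus_mps :: "'a mps \<Rightarrow> 'a mps \<Rightarrow> 'a mps" is "\<lambda>f g m. f m + g m" .
lift_definition minus_mps :: "'a mps \<Rightarrow> 'a mps \<Rightarrow> 'a mps" is "\<lambda>f g m. f m - g m" .
lift_definition uminus_mps :: "'a mps \<Rightarrow> 'a mps" is "\<lambda>f m. - f m" .
lift_definition times_mps :: "'a mps \<Rightarrow> 'a mps \<Rightarrow> 'a mps" is
  "\<lambda>f g m. \<Sum>(a, b)\<in>antidiag m. f a * g b" .

instance
proof
  fix f g h :: "'a mps"
  show "f * g * h = f * (g * h)"
  proof transfer
    fix f g h :: "expo \<Rightarrow> 'a"
    show "(\<lambda>m. \<Sum>(a, b)\<in>antidiag m. (\<Sum>(c, d)\<in>antidiag a. f c * g d) * h b) =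
          (\<lambda>m. \<Sum>(a, b)\<in>antidiag m. f a * (\<Sum>(c, d)\<in>antidiag b. g c * h d))"
    proof
      fix m
      have "(\<Sum>(a, b)\<in>antidiag m. (\<Sum>(c, d)\<in>antidiag a. f c * g d) * h b) =
            (\<Sum>((a, b), (c, d))\<in>Sigma (antidiag m) (\<lambda>(a, b). antidiag a). f c * g d * h b)"
        by (subst sum.Sigma[symmetric]) (auto simp: sum_distrib_right split_def)
      also have "\<dots> = (\<Sum>((a, b), (c, d))\<in>Sigma (antidiag m) (\<lambda>(a, b). antidiag b). f a * (g c * h d))"
        by (rule sum.reindex_bij_witness
              [where j = "\<lambda>((a, b), (c, d)). ((c, d + b), (d, b))"
                 and i = "\<lambda>((a, b), (c, d)). ((a + c, d), (a, c))"])
           (auto simp: antidiag_def algebra_simps)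
      also have "\<dots> = (\<Sum>(a, b)\<in>antidiag m. f a * (\<Sum>(c, d)\<in>antidiag b. g c * h d))"
        by (subst sum.Sigma[symmetric]) (auto simp: sum_distrib_left split_def)
      finally show "(\<Sum>(a, b)\<in>antidiag m. (\<Sum>(c, d)\<in>antidiag a. f c * g d) * h b) =
          (\<Sum>(a, b)\<in>antidiag m. f a * (\<Sum>(c, d)\<in>antidiag b. g c * h d))" .
    qed
  qed
  show "f * g = g * f"
  proof transfer
    fix f g :: "expo \<Rightarrow> 'a"
    show "(\<lambda>m. \<Sum>(a, b)\<in>antidiag m. f a * g b) = (\<lambda>m. \<Sum>(a, b)\<in>antidiag m. g a * f b)"
    proof
      fix m
      show "(\<Sum>(a, b)\<in>antidiag m. f a * g b) = (\<Sum>(a, b)\<in>antidiag m. g a * f b)"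
        by (rule sum.reindex_bij_witness[where j = prod.swap and i = prod.swap])
           (auto simp: antidiag_def algebra_simps)
    qed
  qed
  show "1 * f = f"
  proof transfer
    fix f :: "expo \<Rightarrow> 'a"
    show "(\<lambda>m. \<Sum>(a, b)\<in>antidiag m. (if a = 0 then 1 else 0) * f b) = f"
    proof
      fix m
      have "(\<Sum>(a, b)\<in>antidiag m. (if a = 0 then 1 else 0) * f b) =
            (\<Sum>(a, b)\<in>{(0 :: expo, m)}. (if a = 0 then 1 else 0) * f b)"
        by (rule sum.mono_neutral_right[OF finite_antidiag]) (auto simp: antidiag_def split: if_splits)
      thus "(\<Sum>(a, b)\<in>antidiag m. (if a = 0 then 1 else 0) * f b) = f m"
        by simp
    qed
  qed
  show "(f + g) * h = f * h + g * h"
    by transfer (simp add: sum.distrib[symmetric] split_def distrib_right)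
  show "(0 :: 'a mps) \<noteq> 1"
    by transfer (metis zero_neq_one)
qed (transfer; simp add: algebra_simps)+

end

lift_definition mps_const :: "'a::zero \<Rightarrow> 'a mps" is "\<lambda>c m. if m = 0 then c else 0" .


section \<open>The ground field \<open>\<rat>(q)\<close> and the ring \<open>\<Lambda>\<close>\<close>

type_synonym Qq = "rat poly fract"

definition qq :: Qq where "qq = Fract [:0, 1:] 1"

definition tt :: Qq where "tt = 1 / qq"

text \<open>\<open>brk x u\<close> is the bracket \<open>[u]\<^sub>x\<close>, for any integer \<open>u\<close>.\<close>
definition brk :: "Qq \<Rightarrow> int \<Rightarrow> Qq" where
  "brk x u = (1 - x powi u) / (1 - x)"

definition MM :: Qq where "MM = (1 - tt) * (1 - qq)"

definition mon_degree :: "expo \<Rightarrow> nat" where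
  "mon_degree m = (\<Sum>i\<in>Poly_Mapping.keys m. Poly_Mapping.lookup m i)"

text \<open>For a bijection \<open>\<pi>\<close>, \<open>map_key \<pi> m\<close> has exponent vector \<open>Poly_Mapping.lookup m \<circ> \<pi>\<close>.\<close>
definition sym_funs :: "Qq mps set" where
  "sym_funs = {f. (\<forall>\<pi> m. bij \<pi> \<longrightarrow> mps_coeff f (Poly_Mapping.map_key \<pi> m) = mps_coeff f m) \<and>
                  (\<exists>d. \<forall>m. mps_coeff f m \<noteq> 0 \<longrightarrow> mon_degree m \<le> d)}"

text \<open>The alphabet \<open>X = x\<^sub>0 + x\<^sub>1 + \<dots>\<close>.\<close>
definition XX :: "Qq mps" where
  "XX = Abs_mps (\<lambda>m. if \<exists>i. m = Poly_Mapping.single i 1 then 1 else 0)"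


section \<open>Plethystic substitution\<close>

text \<open>
  An expression \<open>E\<close> is a formal Laurent series in \<open>z\<close> whose coefficients are power series in the
  \<open>x\<^sub>i\<close> over \<open>\<rat>(q)\<close>. The maps \<open>pk_q\<close>, \<open>pk_mps\<close> and \<open>pk\<close> replace every variable by its \<open>k\<close>-th power
  (\<open>k > 0\<close>) in, respectively, a rational function of \<open>q\<close>, a series in \<open>q\<close> and the \<open>x\<^sub>i\<close>, and an
  expression involving also \<open>z\<close>. Thus \<open>pk k E\<close> is \<open>p\<^sub>k[E]\<close>.
\<close>

definition pk_q :: "nat \<Rightarrow> Qq \<Rightarrow> Qq" where
  "pk_q k c = (THE d. \<exists>a b. b \<noteq> 0 \<and> c = Fract a b \<and>
                            d = Fract (a \<circ>\<^sub>p monom 1 k) (b \<circ>\<^sub>p monom 1 k))"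

lemma pcompose_monom_eq_0_iff:
  fixes a :: "rat poly"
  assumes "0 < k"
  shows "a \<circ>\<^sub>p monom 1 k = 0 \<longleftrightarrow> a = 0"
  using pcompose_eq_0[of a "monom 1 k"] assms by (auto simp: degree_monom_eq)

lemma pk_q_Fract:
  assumes "0 < k" "b \<noteq> 0"
  shows "pk_q k (Fract a b) = Fract (a \<circ>\<^sub>p monom 1 k) (b \<circ>\<^sub>p monom 1 k)"
  unfolding pk_q_def
proof (rule the_equality)
  fix d
  assume "\<exists>a' b'. b' \<noteq> 0 \<and> Fract a b = Fract a' b' \<and>
                  d = Fract (a' \<circ>\<^sub>p monom 1 k) (b' \<circ>\<^sub>p monom 1 k)"
  then obtain a' b' where *: "b' \<noteq> 0" "Fract a b = Fract a' b'"
      "d = Fract (a' \<circ>\<^sub>p monom 1 k) (b' \<circ>\<^sub>p monom 1 k)"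
    by blast
  have "(a * b') \<circ>\<^sub>p monom 1 k = (a' * b) \<circ>\<^sub>p monom 1 k"
    using * assms by (simp add: eq_fract)
  thus "d = Fract (a \<circ>\<^sub>p monom 1 k) (b \<circ>\<^sub>p monom 1 k)"
    using * assms by (simp add: eq_fract pcompose_mult pcompose_monom_eq_0_iff)
qed (use assms in blast)

lemma pk_q_0 [simp]: "0 < k \<Longrightarrow> pk_q k 0 = 0"
  by (simp add: Zero_fract_def pk_q_Fract pcompose_1)

definition pk_mps :: "nat \<Rightarrow> Qq mps \<Rightarrow> Qq mps" where
  "pk_mps k f = Abs_mps (\<lambda>m.
     if \<forall>i. k dvd Poly_Mapping.lookup m i
     then pk_q k (mps_coeff f (Poly_Mapping.map (\<lambda>e. e div k) m)) else 0)"

lemma pk_mps_0 [simp]: "0 < k \<Longrightarrow> pk_mps k 0 = 0"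
  by (rule mps_eqI) (simp add: pk_mps_def Abs_mps_inverse zero_mps.rep_eq)

definition pk :: "nat \<Rightarrow> Qq mps fls \<Rightarrow> Qq mps fls" where
  "pk k E = Abs_fls (\<lambda>n. pk_mps k (fls_compose_power E k $$ n))"

lemma pk_nth: "0 < k \<Longrightarrow> pk k E $$ n = pk_mps k (fls_compose_power E k $$ n)"
proof -
  assume k: "0 < k"
  have "\<forall>\<^sub>\<infinity>n. fls_compose_power E k $$ (- int n) = 0"
    by (rule MOST_fls_neg_nth_eq_0)
  hence "\<forall>\<^sub>\<infinity>n. pk_mps k (fls_compose_power E k $$ (- int n)) = 0"
    by (rule MOST_mono) (simp add: k)
  thus ?thesis
    by (simp add: pk_def)
qed

text \<open>
  A polynomial in the power sums is an element of \<open>expo \<Rightarrow>\<^sub>0 \<rat>(q)\<close>, its \<open>i\<close>-th variable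
  (\<open>i = 0, 1, \<dots>\<close>) standing for \<open>p\<^bsub>i+1\<^esub>\<close>. The map \<open>ps_subst\<close> evaluates such a polynomial in
  a ring into which \<open>\<rat>(q)\<close> is embedded by \<open>\<iota>\<close>, substituting \<open>\<phi> k\<close> for \<open>p\<^sub>k\<close>.
\<close>

definition ps_subst :: "(Qq \<Rightarrow> 'a::comm_ring_1) \<Rightarrow> (nat \<Rightarrow> 'a) \<Rightarrow> (expo \<Rightarrow>\<^sub>0 Qq) \<Rightarrow> 'a" where
  "ps_subst \<iota> \<phi> P =
     (\<Sum>m\<in>Poly_Mapping.keys P. \<iota> (Poly_Mapping.lookup P m) *
        (\<Prod>i\<in>Poly_Mapping.keys m. \<phi> (Suc i) ^ Poly_Mapping.lookup m i))"

text \<open>The expression of a symmetric function as a polynomial in the power sums \<open>p\<^sub>k = \<Sum>\<^sub>i x\<^sub>i\<^sup>k\<close>;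
  meaningful only on \<^const>\<open>sym_funs\<close>.\<close>
definition ps_expansion :: "Qq mps \<Rightarrow> (expo \<Rightarrow>\<^sub>0 Qq)" where
  "ps_expansion F = (THE P. ps_subst mps_const (\<lambda>k. pk_mps k XX) P = F)"

definition pleth :: "Qq mps \<Rightarrow> Qq mps fls \<Rightarrow> Qq mps fls" where
  "pleth F E = ps_subst (\<lambda>c. fls_const (mps_const c)) (\<lambda>k. pk k E) (ps_expansion F)"

text \<open>
  \<open>\<Omega>[E] = exp (\<Sum>k\<ge>1. p\<^sub>k[E] / k)\<close> for an expression \<open>E\<close> having only positive powers of \<open>z\<close>. For such
  \<open>E\<close>, \<open>p\<^sub>k[E]\<close> is divisible by \<open>z\<^sup>k\<close>, so only \<open>k \<le> n\<close> contribute to the coefficient of \<open>z\<^sup>n\<close> of the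
  inner sum, which has no constant term.
\<close>
definition Omega :: "Qq mps fls \<Rightarrow> Qq mps fls" where
  "Omega E = fps_to_fls
     (Abs_fps (\<lambda>j. mps_const (1 / fact j)) oo
      Abs_fps (\<lambda>n. \<Sum>k=1..n. mps_const (1 / of_nat k) * pk k E $$ int n))"


section \<open>The operators \<open>D\<^bsub>u,v\<^esub>\<close> and \<open>Q\<^sup>s\<^bsub>m,n\<^esub>\<close>\<close>

definition D_op :: "int \<Rightarrow> int \<Rightarrow> Qq mps \<Rightarrow> Qq mps" where
  "D_op u v F =
     (pleth F (fls_const XX + fls_const (mps_const (MM * brk qq u)) * fls_X_inv) *
      Omega (- (fls_X * fls_const (mps_const (brk tt u)) * fls_const XX))) $$ v"

definition scaled_commutator ::
    "(Qq mps \<Rightarrow> Qq mps) \<Rightarrow> (Qq mps \<Rightarrow> Qq mps) \<Rightarrow> Qq mps \<Rightarrow> Qq mps" where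
  "scaled_commutator A B F = mps_const (1 / MM) * (A (B F) - B (A F))"

text \<open>
  The lattice points of the \<open>km \<times> kn\<close> rectangle strictly below and closest to the diagonal. As
  \<open>a, m, n\<close> are positive, integer solutions of \<open>n a - m b = 1\<close> automatically have \<open>b \<ge> 0\<close>, and
  in the subtractions below nothing is truncated.
\<close>
definition closest_below :: "nat \<Rightarrow> nat \<Rightarrow> nat \<Rightarrow> (nat \<times> nat) set" where
  "closest_below k m n = {(a, b). 1 \<le> a \<and> a \<le> k * m - 1 \<and> n * a = m * b + 1}"

definition split_point :: "nat \<Rightarrow> nat \<Rightarrow> nat \<times> nat" where
  "split_point m n = (THE ab. ab \<in> closest_below 1 m n)"

lemma closest_below_ex1:
  assumes "coprime m n" "2 \<le> m"
  shows "\<exists>!ab. ab \<in> closest_below 1 m n"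
proof -
  obtain x where "[n * x = Suc 0] (mod m)"
    using cong_solve_coprime_nat[of n m] assms by (auto simp: coprime_commute)
  hence "(n * (x mod m)) mod m = 1"
    using assms by (simp add: cong_def mod_mult_right_eq)
  moreover define a where "a = x mod m"
  ultimately have amod: "(n * a) mod m = 1"
    by simp
  define b where "b = (n * a) div m"
  have eq: "n * a = m * b + 1"
    unfolding b_def using mult_div_mod_eq[of m "n * a"] amod by simp
  have "a \<noteq> 0"
    using eq by (intro notI) simp
  moreover have "a < m"
    using assms unfolding a_def by simp
  ultimately have mem: "(a, b) \<in> closest_below 1 m n"
    using eq by (simp add: closest_below_def)
  have "ab = (a, b)" if "ab \<in> closest_below 1 m n" for ab
  proof -
    obtain a' b' where ab: "ab = (a', b')"
      by (cases ab)
    have a': "a' < m" "n * a' = m * b' + 1"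
      using that assms by (auto simp: ab closest_below_def)
    have "[n * a' = n * a] (mod m)"
      unfolding eq a'(2) by (simp only: cong_def mod_mult_self4)
    hence "[a' = a] (mod m)"
      using assms cong_mult_lcancel_nat[of n m a' a] by (auto simp: coprime_commute)
    hence "a' = a"
      using \<open>a < m\<close> a' by (simp add: cong_def)
    moreover from this have "b' = b"
      using eq a' assms by simp
    ultimately show ?thesis
      by (simp add: ab)
  qed
  thus ?thesis
    using mem by blast
qed

lemma split_point_mem:
  assumes "coprime m n" "2 \<le> m"
  shows "split_point m n \<in> closest_below 1 m n"
  unfolding split_point_def by (rule theI') (rule closest_below_ex1[OF assms])

text \<open>\<open>Q\<^sup>s\<^bsub>m,n\<^esub>\<close> for coprime \<open>m \<ge> 1\<close> and \<open>n \<ge> 0\<close>; the value \<open>n = 0\<close> occurs only for \<open>m = 1\<close>.\<close>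
function Q_coprime :: "nat \<Rightarrow> nat \<Rightarrow> Qq mps \<Rightarrow> Qq mps" where
  "Q_coprime m n =
     (if m = 1 then D_op 1 (int n)
      else if 2 \<le> m \<and> coprime m n then
        scaled_commutator
          (Q_coprime (m - fst (split_point m n)) (n - snd (split_point m n)))
          (Q_coprime (fst (split_point m n)) (snd (split_point m n)))
      else undefined)"
  by pat_completeness auto
termination
proof (relation "measure fst")
  fix m n :: nat
  assume "m \<noteq> 1" "2 \<le> m \<and> coprime m n"
  hence "1 \<le> fst (split_point m n)" "fst (split_point m n) \<le> m - 1" "2 \<le> m"
    using split_point_mem[of m n] by (auto simp: closest_below_def)
  thus "((m - fst (split_point m n), n - snd (split_point m n)), (m, n)) \<in> measure fst"
    and "((fst (split_point m n), snd (split_point m n)), (m, n)) \<in> measure fst"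
    by auto
qed simp

declare Q_coprime.simps [simp del]

text \<open>
  For coprime positive \<open>m, n\<close>: the set of operators arising as \<open>Q\<^sup>s\<^bsub>km,kn\<^esub>\<close>, one for each
  admissible choice of \<open>(a, b)\<close> if \<open>k \<ge> 2\<close>. That the choices agree is not presupposed.
\<close>
definition Q_ops :: "nat \<Rightarrow> nat \<Rightarrow> nat \<Rightarrow> (Qq mps \<Rightarrow> Qq mps) set" where
  "Q_ops k m n =
     (if k = 1 then {Q_coprime m n}
      else {scaled_commutator (Q_coprime (k * m - a) (k * n - b)) (Q_coprime a b) | a b.
              (a, b) \<in> closest_below k m n})"

lemma Q_ops_nonempty:
  assumes "coprime m n" "0 < m" "0 < n" "1 \<le> k"
  shows "Q_ops k m n \<noteq> {}"
proof (cases "k = 1")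
  case False
  have "closest_below k m n \<noteq> {}"
  proof (cases "m = 1")
    case True
    hence "(1, n - 1) \<in> closest_below k m n"
      using assms False by (auto simp: closest_below_def)
    thus ?thesis by blast
  next
    case False
    hence "closest_below 1 m n \<noteq> {}"
      using closest_below_ex1[of m n] assms by auto
    moreover have "m - 1 \<le> k * m - 1"
      using assms by (simp add: diff_le_mono)
    hence "closest_below 1 m n \<subseteq> closest_below k m n"
      by (auto simp: closest_below_def)
    ultimately show ?thesis by blast
  qed
  thus ?thesis
    using False by (auto simp: Q_ops_def)
qed (simp add: Q_ops_def)

text \<open>The exponent \<open>(km-1)(kn-1)/2 + (k-1)/2\<close> is an integer.\<close>
lemma even_exponent:
  fixes k m n :: nat
  assumes "coprime m n" "0 < m" "0 < n" "1 \<le> k"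
  shows "even ((k * m - 1) * (k * n - 1) + (k - 1))"
proof -
  have "odd m \<or> odd n"
    using assms(1) by (meson coprime_common_divisor_nat coprime_def odd_one)
  thus ?thesis
    using assms by auto
qed

end

(*
  Call F[X] -> F[X + M[u]_q/z] the shift by u and write E_u(z) for Omega[-z[u]_t X].
  Moving the shift by u1 past E_u2 multiplies by the rational function
  (1 - w)(1 - w q^(u1-u2)) / ((1 - w q^u1)(1 - w q^(-u2))), w = z2/z1,
  and exchanging the two operators gives the same rational function expanded in 1/w. The commutator
  [D_(u1,v1), D_(u2,v2)] therefore only sees delta functions at the two poles. At w = q^(-u1) and at
  w = q^u2 both factors merge, because [u1] + q^u1 [u2] = [u1 + u2], and the result is
  -(1 - q^u1)(1 - q^u2)/(1 - q^(u1+u2)) (q^(u1 v2) - q^(u2 v1)) D_(u1+u2,v1+v2).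
  The theorem follows by induction along the definition of Q.

  All computations take place in the polynomial ring in the p_k. As the p_k are algebraically
  independent, an identity there can be carried over to symmetric functions; that they also generate
  the ring is never needed, because D F depends on F only through its expansion in power sums.
*)
theory Submission
  imports Defs
begin

section \<open>Ring homomorphisms and polynomials in the power sums\<close>

text \<open>Put a = q^u1 and b = q^(-u2). The rational function is 1 + A (1/(1 - a w) - 1/(1 - b
  w)), and its expansion in 1/w is 1 plus A times the sum over s >= 1 of (b^(-s) - a^(-s)) w^(-s),
  with the same A. The difference of the two expansions is A times the sum over all integers s of
  (a^s - b^s) w^s. No two-sided series is formed: 1/z is a polynomial variable y and E_u is a power
  series in z, so every coefficient is a finite sum. A delta function then appears as two one-sided
  sums and a middle term glued into one convolution, see \<open>convolution_shift\<close>.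

  Products of exponentials are compared through z E'(z) = G(z) E(z), where products become sums and
  each p_k enters G linearly. Recovering E from G means cancelling positive integers, which the
  polynomial ring, an integral domain of characteristic 0, permits.\<close>

locale unital_hom =
  fixes f :: "'a::comm_ring_1 \<Rightarrow> 'b::comm_ring_1"
  assumes hom_one [simp]: "f 1 = 1"
    and hom_add [simp]: "f (x + y) = f x + f y"
    and hom_mult [simp]: "f (x * y) = f x * f y"
begin

lemma hom_zero [simp]: "f 0 = 0"
  using hom_add[of 0 0] by simp

lemma hom_uminus [simp]: "f (- x) = - f x"
  using hom_add[of x "- x"] by (simp add: eq_neg_iff_add_eq_0 add.commute)

lemma hom_diff [simp]: "f (x - y) = f x - f y"
  using hom_add[of x "- y"] by simp

lemma hom_sum [simp]: "f (sum g A) = (\<Sum>x\<in>A. f (g x))"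
  by (induction A rule: infinite_finite_induct) auto

lemma hom_power [simp]: "f (x ^ n) = f x ^ n"
  by (induction n) auto

lemma hom_of_nat [simp]: "f (of_nat n) = of_nat n"
  by (induction n) auto

lemma map_poly_hom: "unital_hom (map_poly f)"
proof
  show "map_poly f (p * q) = map_poly f p * map_poly f q" for p q
    by (rule poly_eqI) (simp add: coeff_map_poly coeff_mult)
qed (auto intro!: poly_eqI simp: coeff_map_poly)

end

lemma unital_hom_comp: "unital_hom f \<Longrightarrow> unital_hom g \<Longrightarrow> unital_hom (\<lambda>x. f (g x))"
  by (simp add: unital_hom_def)

lemma unital_hom_poly: "unital_hom (\<lambda>p. poly p x)"
  by standard auto

definition ps_const :: "Qq \<Rightarrow> expo \<Rightarrow>\<^sub>0 Qq" where
  "ps_const c = Poly_Mapping.single 0 c"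

text \<open>Truncated subtraction makes \<open>ps_gen 0\<close> coincide with
  \<open>ps_gen 1\<close>, hence the guard \<open>0 < k\<close> wherever \<open>ps_gen k\<close> is
  to mean p_k.\<close>

definition ps_gen :: "nat \<Rightarrow> expo \<Rightarrow>\<^sub>0 Qq" where
  "ps_gen k = Poly_Mapping.single (Poly_Mapping.single (k - 1) 1) 1"

interpretation ps_const: unital_hom ps_const
  by standard (simp_all add: ps_const_def single_add mult_single)

lemma single_eq_sum_keys: "P = (\<Sum>m\<in>Poly_Mapping.keys P. Poly_Mapping.single m (Poly_Mapping.lookup P m))"
  by (rule poly_mapping_eqI)
    (auto simp: lookup_sum lookup_single when_def sum.delta in_keys_iff)

lemma single_single_power: "Poly_Mapping.single (Poly_Mapping.single i e) (1::Qq) = ps_gen (Suc i) ^ e"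
proof (induction e)
  case (Suc e)
  have "Poly_Mapping.single (Poly_Mapping.single i (Suc e)) (1::Qq)
      = ps_gen (Suc i) * Poly_Mapping.single (Poly_Mapping.single i e) 1"
    by (simp add: ps_gen_def mult_single flip: single_add)
  thus ?case using Suc by simp
qed simp

lemma single_monomial_sum:
  "finite A \<Longrightarrow> Poly_Mapping.single (sum g A) (1::Qq) = (\<Prod>i\<in>A. Poly_Mapping.single (g i) 1)"
  proof (induction A rule: finite_induct)
  case (insert x F)
  thus ?case using mult_single[of "g x" "1::Qq" "sum g F" 1] by simp
qed simp

lemma single_monomial:
  fixes m :: expo
  shows "Poly_Mapping.single m c =
    ps_const c * (\<Prod>i\<in>Poly_Mapping.keys m. ps_gen (Suc i) ^ Poly_Mapping.lookup m i)"
proof -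
  have m: "m = (\<Sum>i\<in>Poly_Mapping.keys m. Poly_Mapping.single i (Poly_Mapping.lookup m i))"
    by (rule poly_mapping_eqI)
      (auto simp: lookup_sum lookup_single when_def sum.delta in_keys_iff)
  have "Poly_Mapping.single m (1::Qq) = (\<Prod>i\<in>Poly_Mapping.keys m. ps_gen (Suc i) ^ Poly_Mapping.lookup m i)"
    by (subst m, subst single_monomial_sum) (simp_all add: single_single_power)
  moreover have "Poly_Mapping.single m c = ps_const c * Poly_Mapping.single m 1"
    by (simp add: ps_const_def mult_single)
  ultimately show ?thesis by simp
qed

text \<open>Besides yielding \<open>hom_eqI\<close>, this induction serves claims about single
  coefficients, such as \<open>double_shift_commute\<close>, that do not compare two
  homomorphisms.\<close>

lemma ps_poly_induct [case_names const gen add mult]: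
  assumes const: "\<And>c. S (ps_const c)"
    and gen: "\<And>k. 0 < k \<Longrightarrow> S (ps_gen k)"
    and add: "\<And>P Q. S P \<Longrightarrow> S Q \<Longrightarrow> S (P + Q)"
    and mult: "\<And>P Q. S P \<Longrightarrow> S Q \<Longrightarrow> S (P * Q)"
  shows "S P"
proof -
  have one: "S 1" using const[of 1] by simp
  have zero: "S 0" using const[of 0] by simp
  have S_sum: "S (sum g A)" if "\<And>x. x \<in> A \<Longrightarrow> S (g x)" for g and A :: "expo set"
    using that by (induction A rule: infinite_finite_induct) (auto intro: add zero)
  have S_prod: "S (prod g A)" if "\<And>x. x \<in> A \<Longrightarrow> S (g x)" for g and A :: "nat set"
    using that by (induction A rule: infinite_finite_induct) (auto intro: mult one)
  have S_pow: "S (x ^ n)" if "S x" for x n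
    using that by (induction n) (auto intro: mult one)
  have "S (Poly_Mapping.single m c)" for m c
    unfolding single_monomial by (intro mult const S_prod S_pow gen) auto
  hence "S (\<Sum>m\<in>Poly_Mapping.keys P. Poly_Mapping.single m (Poly_Mapping.lookup P m))"
    by (intro S_sum)
  thus ?thesis using single_eq_sum_keys[of P] by simp
qed

lemma hom_eqI:
  assumes "unital_hom f" "unital_hom g"
    and "\<And>c. f (ps_const c) = g (ps_const c)"
    and "\<And>k. 0 < k \<Longrightarrow> f (ps_gen k) = g (ps_gen k)"
  shows "f P = g P"
  using assms by (induction P rule: ps_poly_induct) (auto simp: unital_hom_def)

context
  fixes \<iota> :: "Qq \<Rightarrow> 'a::comm_ring_1" and \<phi> :: "nat \<Rightarrow> 'a"
  assumes iota: "unital_hom \<iota>"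
begin

interpretation iota: unital_hom \<iota> by (rule iota)

definition eval_monomial :: "expo \<Rightarrow> 'a" where
  "eval_monomial m = (\<Prod>i\<in>Poly_Mapping.keys m. \<phi> (Suc i) ^ Poly_Mapping.lookup m i)"

text \<open>Polynomials with different supports can be evaluated over one common index set.\<close>

private lemma eval_superset:
  assumes "finite A" "Poly_Mapping.keys P \<subseteq> A"
  shows "ps_subst \<iota> \<phi> P = (\<Sum>m\<in>A. \<iota> (Poly_Mapping.lookup P m) * eval_monomial m)"
  unfolding ps_subst_def eval_monomial_def
  by (rule sum.mono_neutral_left) (use assms in \<open>auto simp: in_keys_iff\<close>)

private lemma eval_monomial_superset:
  assumes "finite A" "Poly_Mapping.keys m \<subseteq> A"
  shows "eval_monomial m = (\<Prod>i\<in>A. \<phi> (Suc i) ^ Poly_Mapping.lookup m i)"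
  unfolding eval_monomial_def
  by (rule prod.mono_neutral_left) (use assms in \<open>auto simp: in_keys_iff\<close>)

private lemma eval_monomial_add: "eval_monomial (m + m') = eval_monomial m * eval_monomial m'"
proof -
  define A where "A = Poly_Mapping.keys m \<union> Poly_Mapping.keys m'"
  have "finite A" "Poly_Mapping.keys m \<subseteq> A" "Poly_Mapping.keys m' \<subseteq> A"
       "Poly_Mapping.keys (m + m') \<subseteq> A"
    using Poly_Mapping.keys_add[of m m'] by (auto simp: A_def)
  thus ?thesis
    by (simp add: eval_monomial_superset[of A] lookup_add power_add prod.distrib)
qed

private lemma eval_single: "ps_subst \<iota> \<phi> (Poly_Mapping.single m c) = \<iota> c * eval_monomial m"
  by (subst eval_superset[of "{m}"]) auto

private lemma eval_add: "ps_subst \<iota> \<phi> (P + Q) = ps_subst \<iota> \<phi> P + ps_subst \<iota> \<phi> Q"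
proof -
  define A where "A = Poly_Mapping.keys P \<union> Poly_Mapping.keys Q"
  have "finite A" "Poly_Mapping.keys P \<subseteq> A" "Poly_Mapping.keys Q \<subseteq> A"
       "Poly_Mapping.keys (P + Q) \<subseteq> A"
    using Poly_Mapping.keys_add[of P Q] by (auto simp: A_def)
  thus ?thesis
    by (simp add: eval_superset[of A] lookup_add ring_distribs sum.distrib)
qed

private lemma eval_sum: "ps_subst \<iota> \<phi> (sum g A) = (\<Sum>x\<in>A. ps_subst \<iota> \<phi> (g x))"
  by (induction A rule: infinite_finite_induct) (simp_all add: eval_add, simp_all add: ps_subst_def)

lemma unital_hom_ps_subst: "unital_hom (ps_subst \<iota> \<phi>)"
proof
  have "ps_subst \<iota> \<phi> (Poly_Mapping.single 0 1) = 1"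
    by (subst eval_single) (simp add: eval_monomial_def)
  thus "ps_subst \<iota> \<phi> 1 = 1" by simp
  show "ps_subst \<iota> \<phi> (P + Q) = ps_subst \<iota> \<phi> P + ps_subst \<iota> \<phi> Q" for P Q
    by (rule eval_add)
  show "ps_subst \<iota> \<phi> (P * Q) = ps_subst \<iota> \<phi> P * ps_subst \<iota> \<phi> Q" for P Q
  proof -
    have "P * Q = (\<Sum>m\<in>Poly_Mapping.keys P. \<Sum>m'\<in>Poly_Mapping.keys Q.
        Poly_Mapping.single (m + m') (Poly_Mapping.lookup P m * Poly_Mapping.lookup Q m'))"
      by (subst (1) single_eq_sum_keys[of P], subst (1) single_eq_sum_keys[of Q])
        (simp add: sum_product mult_single)
    moreover have "ps_subst \<iota> \<phi> P * ps_subst \<iota> \<phi> Q =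
        (\<Sum>m\<in>Poly_Mapping.keys P. \<Sum>m'\<in>Poly_Mapping.keys Q.
          \<iota> (Poly_Mapping.lookup P m) * eval_monomial m * (\<iota> (Poly_Mapping.lookup Q m') * eval_monomial m'))"
      unfolding sum_product[symmetric] by (simp add: ps_subst_def eval_monomial_def)
    ultimately show ?thesis
      by (simp add: eval_sum eval_single eval_monomial_add mult_ac)
  qed
qed

lemma ps_subst_const [simp]: "ps_subst \<iota> \<phi> (ps_const c) = \<iota> c"
  by (simp add: ps_const_def eval_single eval_monomial_def)

lemma ps_subst_gen [simp]: "0 < k \<Longrightarrow> ps_subst \<iota> \<phi> (ps_gen k) = \<phi> k"
  by (simp add: ps_gen_def eval_single eval_monomial_def)

end

section \<open>Algebraic independence of the power sums\<close>

lemma expo_plus_eq_0: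
  fixes a b :: expo
  assumes "a + b = 0"
  shows "a = 0" "b = 0"
proof -
  have "Poly_Mapping.lookup a i + Poly_Mapping.lookup b i = 0" for i
    using assms by (metis lookup_add lookup_zero)
  thus "a = 0" "b = 0" by (auto intro!: poly_mapping_eqI)
qed

lemma sum_in_Nats: "(\<And>x. x \<in> A \<Longrightarrow> g x \<in> \<nat>) \<Longrightarrow> sum g A \<in> (\<nat> :: 'a::semiring_1 set)"
  by (induction A rule: infinite_finite_induct) auto

lemma ex_max_image:
  fixes f :: "'a \<Rightarrow> 'b::linorder"
  assumes "finite A" "A \<noteq> {}"
  shows "\<exists>x\<in>A. \<forall>y\<in>A. f y \<le> f x"
proof -
  have "Max (f ` A) \<in> f ` A" using assms by (intro Max_in) auto
  then obtain x where "Max (f ` A) = f x" "x \<in> A" by (rule imageE)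
  thus ?thesis using assms by (metis Max_ge finite_imageI imageI)
qed

interpretation mps_const: unital_hom mps_const
proof
  show "mps_const (x * y) = mps_const x * mps_const y" for x y :: 'a
  proof (rule mps_eqI)
    fix m
    show "mps_coeff (mps_const (x * y)) m = mps_coeff (mps_const x * mps_const y) m"
    proof (cases "m = 0")
      case True
      have "antidiag 0 = {(0, 0)}"
        by (auto simp: antidiag_def dest: expo_plus_eq_0)
      thus ?thesis using True by (simp add: mps_const.rep_eq times_mps.rep_eq)
    next
      case False
      thus ?thesis
        by (auto simp: mps_const.rep_eq times_mps.rep_eq antidiag_def intro!: sum.neutral)
    qed
  qed
qed (auto intro!: mps_eqI simp: mps_const.rep_eq one_mps.rep_eq plus_mps.rep_eq)

lemma mps_coeff_sum: "mps_coeff (sum g A) m = (\<Sum>x\<in>A. mps_coeff (g x) m)"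
  by (induction A rule: infinite_finite_induct) (auto simp: zero_mps.rep_eq plus_mps.rep_eq)

lemma mps_coeff_const_times: "mps_coeff (mps_const c * f) m = c * mps_coeff f m"
proof -
  have "mps_coeff (mps_const c * f) m = (\<Sum>(a, b)\<in>antidiag m. (if a = 0 then c else 0) * mps_coeff f b)"
    by (simp add: times_mps.rep_eq mps_const.rep_eq)
  also have "\<dots> = (\<Sum>(a, b)\<in>{(0 :: expo, m)}. (if a = 0 then c else 0) * mps_coeff f b)"
    by (rule sum.mono_neutral_right[OF finite_antidiag]) (auto simp: antidiag_def split: if_splits)
  finally show ?thesis by simp
qed

section \<open>Raising all variables to the k-th power\<close>

lemma unital_hom_pk_q:
  assumes k: "0 < k"
  shows "unital_hom (pk_q k)"
proof
  have nz: "x \<circ>\<^sub>p monom 1 k \<noteq> 0" if "x \<noteq> 0" for x :: "rat poly"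
    using that pcompose_monom_eq_0_iff[OF k] by simp
  show "pk_q k 1 = 1"
    using pk_q_Fract[OF k, of 1 1] by (simp add: One_fract_def pcompose_1)
  show "pk_q k (x + y) = pk_q k x + pk_q k y" for x y
    by (cases x; cases y) (simp add: pk_q_Fract k nz pcompose_add pcompose_mult)
  show "pk_q k (x * y) = pk_q k x * pk_q k y" for x y
    by (cases x; cases y) (simp add: pk_q_Fract k nz pcompose_mult)
qed

lemma pk_mps_const:
  assumes "0 < k"
  shows "pk_mps k (mps_const c) = mps_const (pk_q k c)"
proof (rule mps_eqI)
  fix m :: expo
  have "m = 0" if "\<forall>i. k dvd Poly_Mapping.lookup m i" "Poly_Mapping.map (\<lambda>e. e div k) m = 0"
  proof (rule poly_mapping_eqI)
    fix i
    have "Poly_Mapping.lookup m i div k = 0"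
      using arg_cong[OF that(2), of "\<lambda>p. Poly_Mapping.lookup p i"]
      by (simp add: Poly_Mapping.map.rep_eq when_def split: if_splits)
    thus "Poly_Mapping.lookup m i = Poly_Mapping.lookup 0 i"
      using that(1) assms by (metis dvd_div_eq_0_iff lookup_zero)
  qed
  moreover have "Poly_Mapping.map (\<lambda>e. e div k) (0 :: expo) = 0"
    by (rule poly_mapping_eqI) (simp add: Poly_Mapping.map.rep_eq when_def)
  ultimately show "mps_coeff (pk_mps k (mps_const c)) m = mps_coeff (mps_const (pk_q k c)) m"
    using assms by (auto simp: pk_mps_def Abs_mps_inverse mps_const.rep_eq)
qed

lemma pk_mps_const_times:
  assumes "0 < k"
  shows "pk_mps k (mps_const c * f) = mps_const (pk_q k c) * pk_mps k f"
proof (rule mps_eqI)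
  interpret unital_hom "pk_q k" using assms by (rule unital_hom_pk_q)
  show "mps_coeff (pk_mps k (mps_const c * f)) m = mps_coeff (mps_const (pk_q k c) * pk_mps k f) m" for m
    by (simp add: pk_mps_def Abs_mps_inverse mps_coeff_const_times)
qed

section \<open>Monomials occurring in products of power sums\<close>

abbreviation psum :: "nat \<Rightarrow> Qq mps" where
  "psum k \<equiv> pk_mps k XX"

lemma mps_coeff_psum:
  assumes k: "0 < k"
  shows "mps_coeff (psum k) m = (if \<exists>i. m = Poly_Mapping.single i k then 1 else 0)"
proof -
  interpret unital_hom "pk_q k" using k by (rule unital_hom_pk_q)
  have "(\<forall>i. k dvd Poly_Mapping.lookup m i) \<and>
         Poly_Mapping.map (\<lambda>e. e div k) m = Poly_Mapping.single i 1 \<longleftrightarrow> m = Poly_Mapping.single i k" for i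
  proof safe
    assume *: "\<forall>i. k dvd Poly_Mapping.lookup m i" "Poly_Mapping.map (\<lambda>e. e div k) m = Poly_Mapping.single i 1"
    show "m = Poly_Mapping.single i k"
    proof (rule poly_mapping_eqI)
      fix j
      have "Poly_Mapping.lookup m j div k = (if i = j then 1 else 0)"
        using arg_cong[OF *(2), of "\<lambda>p. Poly_Mapping.lookup p j"]
        by (simp add: Poly_Mapping.map.rep_eq when_def lookup_single split: if_splits)
      moreover have "Poly_Mapping.lookup m j = k * (Poly_Mapping.lookup m j div k)"
        using *(1) by simp
      ultimately show "Poly_Mapping.lookup m j = Poly_Mapping.lookup (Poly_Mapping.single i k) j"
        by (simp add: lookup_single when_def split: if_splits)
    qed
  next
    show "Poly_Mapping.map (\<lambda>e. e div k) (Poly_Mapping.single i k) = Poly_Mapping.single i 1"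
      by (rule poly_mapping_eqI) (use k in \<open>auto simp: Poly_Mapping.map.rep_eq when_def lookup_single\<close>)
  qed (auto simp: lookup_single when_def)
  hence "(\<forall>i. k dvd Poly_Mapping.lookup m i) \<and>
         (\<exists>i. Poly_Mapping.map (\<lambda>e. e div k) m = Poly_Mapping.single i 1) \<longleftrightarrow>
         (\<exists>i. m = Poly_Mapping.single i k)"
    by blast
  thus ?thesis by (auto simp: pk_mps_def XX_def Abs_mps_inverse)
qed

text \<open>The partition formed by the positive exponents of a monomial; it forgets which variables
  carry them.\<close>

definition exponents :: "expo \<Rightarrow> nat multiset" where
  "exponents m = image_mset (Poly_Mapping.lookup m) (mset_set (Poly_Mapping.keys m))"

lemma size_exponents: "size (exponents m) = card (Poly_Mapping.keys m)"
  by (simp add: exponents_def)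

lemma keys_single_plus:
  fixes m :: expo
  assumes "0 < a"
  shows "Poly_Mapping.keys (Poly_Mapping.single i a + m) = insert i (Poly_Mapping.keys m)"
  using assms by (auto simp: in_keys_iff lookup_add lookup_single when_def split: if_splits)

lemma exponents_single_plus:
  assumes "0 < a" "i \<notin> Poly_Mapping.keys m"
  shows "exponents (Poly_Mapping.single i a + m) = add_mset a (exponents m)"
proof -
  have "image_mset (Poly_Mapping.lookup (Poly_Mapping.single i a + m)) (mset_set (Poly_Mapping.keys m))
      = exponents m"
    unfolding exponents_def
    by (rule image_mset_cong) (use assms in \<open>auto simp: lookup_add lookup_single when_def\<close>)
  moreover have "Poly_Mapping.lookup (Poly_Mapping.single i a + m) i = a"
    using assms by (simp add: lookup_add lookup_single in_keys_iff)
  ultimately show ?thesis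
    using assms by (simp add: exponents_def keys_single_plus)
qed

lemma ex_exponents: "\<exists>m. exponents m = M" if "0 \<notin># M"
  using that
proof (induction M)
  case empty
  show ?case by (rule exI[of _ 0]) (simp add: exponents_def)
next
  case (add a M)
  then obtain m where m: "exponents m = M" by auto
  obtain i where "i \<notin> Poly_Mapping.keys m"
    using ex_new_if_finite[OF infinite_UNIV_nat finite_keys] by blast
  thus ?case using add.prems m exponents_single_plus[of a i m] by auto
qed

definition psum_prod :: "nat multiset \<Rightarrow> Qq mps" where
  "psum_prod M = (\<Prod>k\<in>#M. psum k)"

lemma mps_coeff_psum_prod_add_mset:
  assumes "0 < a"
  shows "mps_coeff (psum_prod (add_mset a M)) m =
    (\<Sum>(x, y)\<in>{(x, y). x + y = m \<and> (\<exists>i. x = Poly_Mapping.single i a)}. mps_coeff (psum_prod M) y)"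
proof -
  have "mps_coeff (psum_prod (add_mset a M)) m =
    (\<Sum>(x, y)\<in>antidiag m. (if \<exists>i. x = Poly_Mapping.single i a then 1 else 0) * mps_coeff (psum_prod M) y)"
    by (simp add: psum_prod_def times_mps.rep_eq mps_coeff_psum assms)
  also have "\<dots> = (\<Sum>(x, y)\<in>{(x, y). x + y = m \<and> (\<exists>i. x = Poly_Mapping.single i a)}. mps_coeff (psum_prod M) y)"
    by (rule sum.mono_neutral_cong_right[OF finite_antidiag]) (auto simp: antidiag_def split: if_splits)
  finally show ?thesis .
qed

text \<open>Natural coefficients cannot cancel, so in \<open>mps_coeff_psum_prod_exponents\<close>
  one nonzero summand is enough.\<close>

lemma mps_coeff_psum_prod_Nats:
  assumes "0 \<notin># M"
  shows "mps_coeff (psum_prod M) m \<in> \<nat>"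
  using assms
proof (induction M arbitrary: m)
  case empty
  thus ?case by (simp add: psum_prod_def one_mps.rep_eq)
next
  case (add a M)
  thus ?case by (auto simp: mps_coeff_psum_prod_add_mset intro!: sum_in_Nats)
qed

text \<open>A monomial of p_lambda arises by placing every part of lambda on some variable. Parts on
  the same variable are added up, so there are at most as many variables as parts, and equality
  means that no two parts were merged.\<close>

lemma mps_coeff_psum_prod_neq_0_imp:
  assumes "0 \<notin># M" "mps_coeff (psum_prod M) m \<noteq> 0"
  shows "card (Poly_Mapping.keys m) \<le> size M \<and>
         (card (Poly_Mapping.keys m) = size M \<longrightarrow> exponents m = M)"
  using assms
proof (induction M arbitrary: m)
  case empty
  thus ?case by (auto simp: psum_prod_def one_mps.rep_eq exponents_def split: if_splits)
next
  case (add a M)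
  hence a: "0 < a" by auto
  have "\<exists>(x, y)\<in>{(x, y). x + y = m \<and> (\<exists>i. x = Poly_Mapping.single i a)}. mps_coeff (psum_prod M) y \<noteq> 0"
    using add.prems(2) unfolding mps_coeff_psum_prod_add_mset[OF a]
    by (rule contrapos_np) (auto intro!: sum.neutral)
  then obtain i y where y: "m = Poly_Mapping.single i a + y" "mps_coeff (psum_prod M) y \<noteq> 0"
    by auto
  have IH: "card (Poly_Mapping.keys y) \<le> size M"
      "card (Poly_Mapping.keys y) = size M \<Longrightarrow> exponents y = M"
    using add.IH[of y] add.prems y by auto
  show ?case
    using IH exponents_single_plus[OF a, of i y]
    by (cases "i \<in> Poly_Mapping.keys y") (auto simp: y(1) keys_single_plus a insert_absorb)
qed

lemma mps_coeff_psum_prod_exponents: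
  assumes "0 \<notin># M" "exponents m = M"
  shows "mps_coeff (psum_prod M) m \<noteq> 0"
  using assms
proof (induction M arbitrary: m)
  case empty
  thus ?case by (auto simp: psum_prod_def one_mps.rep_eq exponents_def mset_set_empty_iff)
next
  case (add a M)
  hence a: "0 < a" by auto
  have "a \<in># exponents m" using add.prems by simp
  then obtain i where i: "i \<in> Poly_Mapping.keys m" "Poly_Mapping.lookup m i = a"
    by (auto simp: exponents_def)
  define y where "y = m - Poly_Mapping.single i a"
  have lookup_y: "Poly_Mapping.lookup y j = (if j = i then 0 else Poly_Mapping.lookup m j)" for j
    using i by (auto simp: y_def lookup_minus lookup_single when_def)
  have m: "m = Poly_Mapping.single i a + y"
    by (rule poly_mapping_eqI) (use i in \<open>auto simp: lookup_add lookup_y lookup_single when_def\<close>)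
  have "i \<notin> Poly_Mapping.keys y" by (simp add: in_keys_iff lookup_y)
  hence "exponents y = M"
    using exponents_single_plus[OF a, of i y] add.prems m by auto
  hence nz: "mps_coeff (psum_prod M) y \<noteq> 0"
    using add by auto
  define S where "S = {(x, y). x + y = m \<and> (\<exists>i. x = Poly_Mapping.single i a)}"
  have fin: "finite S"
    by (rule finite_subset[OF _ finite_antidiag[of m]]) (auto simp: S_def antidiag_def)
  have mem: "(Poly_Mapping.single i a, y) \<in> S" using m by (auto simp: S_def)
  \<comment> \<open>Over the naturals a sum vanishes only if all summands do, so the nonzero summand
    at \<open>y\<close> settles the claim.\<close>
  have "\<forall>y. \<exists>n. mps_coeff (psum_prod M) y = of_nat n"
    using mps_coeff_psum_prod_Nats[of M] add.prems(1) by (auto elim!: Nats_cases)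
  then obtain g where g: "\<And>y. mps_coeff (psum_prod M) y = of_nat (g y)"
    by metis
  have "g y \<noteq> 0" using nz g by auto
  hence "(\<Sum>(x, y)\<in>S. g y) \<noteq> 0"
    using fin mem by (simp add: sum_eq_0_iff) (intro bexI[of _ "(Poly_Mapping.single i a, y)"], auto)
  moreover have "mps_coeff (psum_prod (add_mset a M)) m = of_nat (\<Sum>(x, y)\<in>S. g y)"
    using a by (simp add: mps_coeff_psum_prod_add_mset S_def g split_def)
  ultimately show ?case by (simp del: of_nat_sum)
qed

text \<open>An exponent vector in the p_k, read as the partition lambda for which the monomial is
  p_lambda.\<close>

definition parts :: "expo \<Rightarrow> nat multiset" where
  "parts \<mu> = (\<Sum>i\<in>Poly_Mapping.keys \<mu>. replicate_mset (Poly_Mapping.lookup \<mu> i) (Suc i))"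

lemma count_parts: "count (parts \<mu>) (Suc i) = Poly_Mapping.lookup \<mu> i"
  by (auto simp: parts_def count_sum in_keys_iff if_distrib sum.delta)

lemma zero_not_in_parts: "0 \<notin># parts \<mu>"
  by (auto simp: parts_def set_mset_sum)

lemma parts_inject: "parts \<mu> = parts \<nu> \<longleftrightarrow> \<mu> = \<nu>"
  by (metis count_parts poly_mapping_eqI)

lemma psum_prod_parts:
  "psum_prod (parts \<mu>) = (\<Prod>i\<in>Poly_Mapping.keys \<mu>. psum (Suc i) ^ Poly_Mapping.lookup \<mu> i)"
proof -
  have "psum_prod (\<Sum>i\<in>A. replicate_mset (g i) (Suc i)) = (\<Prod>i\<in>A. psum (Suc i) ^ g i)" for A g
    by (induction A rule: infinite_finite_induct) (auto simp: psum_prod_def)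
  thus ?thesis by (simp add: parts_def)
qed

definition realize :: "(expo \<Rightarrow>\<^sub>0 Qq) \<Rightarrow> Qq mps" where
  "realize = ps_subst mps_const psum"

interpretation realize: unital_hom realize
  unfolding realize_def by (rule unital_hom_ps_subst) (rule mps_const.unital_hom_axioms)

lemma realize_const [simp]: "realize (ps_const c) = mps_const c"
  unfolding realize_def by (rule ps_subst_const) (rule mps_const.unital_hom_axioms)

lemma realize_gen [simp]: "0 < k \<Longrightarrow> realize (ps_gen k) = psum k"
  unfolding realize_def by (rule ps_subst_gen) (rule mps_const.unital_hom_axioms)

text \<open>Among the monomials of \<open>P\<close> take one with the largest number of factors \<open>p\<^sub>k\<close>, say
  \<open>p\<^bsub>\<lambda>\<^sub>1\<^esub> \<dots> p\<^bsub>\<lambda>\<^sub>l\<^esub>\<close>. No other monomial of \<open>P\<close> contributes to the coefficient of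
  \<open>x\<^sub>1\<^bsup>\<lambda>\<^sub>1\<^esup> \<dots> x\<^sub>l\<^bsup>\<lambda>\<^sub>l\<^esup>\<close>.\<close>
lemma realize_eq_0_imp:
  assumes "realize P = 0"
  shows "P = 0"
proof (rule ccontr)
  assume "P \<noteq> 0"
  hence "Poly_Mapping.keys P \<noteq> {}" by simp
  then obtain \<mu> where \<mu>: "\<mu> \<in> Poly_Mapping.keys P"
      and max: "\<And>\<nu>. \<nu> \<in> Poly_Mapping.keys P \<Longrightarrow> size (parts \<nu>) \<le> size (parts \<mu>)"
    using ex_max_image[OF finite_keys, of P "\<lambda>\<nu>. size (parts \<nu>)"] by blast
  obtain m where m: "exponents m = parts \<mu>"
    using ex_exponents[OF zero_not_in_parts] by blast
  have "\<nu> = \<mu>" if "\<nu> \<in> Poly_Mapping.keys P" "mps_coeff (psum_prod (parts \<nu>)) m \<noteq> 0" for \<nu>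
  proof -
    have "card (Poly_Mapping.keys m) \<le> size (parts \<nu>)"
      "card (Poly_Mapping.keys m) = size (parts \<nu>) \<Longrightarrow> exponents m = parts \<nu>"
      using mps_coeff_psum_prod_neq_0_imp[OF zero_not_in_parts that(2)] by auto
    moreover have "card (Poly_Mapping.keys m) = size (parts \<mu>)"
      using size_exponents[of m] unfolding m by simp
    ultimately have "exponents m = parts \<nu>"
      using max[OF that(1)] by linarith
    thus ?thesis unfolding m parts_inject by simp
  qed
  hence "mps_coeff (realize P) m = (\<Sum>\<nu>\<in>{\<mu>}. Poly_Mapping.lookup P \<nu> * mps_coeff (psum_prod (parts \<nu>)) m)"
    unfolding realize_def ps_subst_def psum_prod_parts[symmetric] mps_coeff_sum mps_coeff_const_times
    using \<mu> by (intro sum.mono_neutral_right) auto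
  also have "\<dots> \<noteq> 0"
    using \<mu> mps_coeff_psum_prod_exponents[OF zero_not_in_parts m] by (simp add: in_keys_iff)
  finally show False using assms by (simp add: zero_mps.rep_eq)
qed

lemma ps_expansion_realize [simp]: "ps_expansion (realize P) = P"
  unfolding ps_expansion_def realize_def[symmetric]
proof (rule the_equality)
  show "Q = P" if "realize Q = realize P" for Q
    using realize_eq_0_imp[of "Q - P"] that by simp
qed simp

section \<open>The exponential series and its image under the plethystic shift\<close>

text \<open>The Euler form \<open>z E'(z) = G(z) E(z)\<close> turns products of series into sums of the \<open>G\<close>.\<close>
definition has_log_deriv :: "'a::comm_ring_1 fps \<Rightarrow> 'a fps \<Rightarrow> bool" where
  "has_log_deriv E G \<longleftrightarrow> E $ 0 = 1 \<and> G $ 0 = 0 \<and> fps_X * fps_deriv E = G * E"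

lemma fps_X_deriv_nth: "(fps_X * fps_deriv E) $ n = of_nat n * E $ n"
  for E :: "'a::comm_ring_1 fps"
  by (cases n) simp_all

lemma has_log_deriv_nth:
  assumes "has_log_deriv E G"
  shows "of_nat n * E $ n = (\<Sum>i=1..n. G $ i * E $ (n - i))"
proof -
  have "of_nat n * E $ n = (\<Sum>i=0..n. G $ i * E $ (n - i))"
    using assms fps_X_deriv_nth[of E n] by (simp add: has_log_deriv_def fps_mult_nth)
  also have "\<dots> = (\<Sum>i=1..n. G $ i * E $ (n - i))"
    using assms by (intro sum.mono_neutral_right) (auto simp: has_log_deriv_def Suc_le_eq)
  finally show ?thesis .
qed

text \<open>The Euler form expresses n times the n-th coefficient by earlier ones, and n can be
  cancelled. It is applied over the polynomials in the p_k and over polynomials in y with such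
  coefficients.\<close>

lemma has_log_deriv_unique:
  fixes E :: "'a::{idom, ring_char_0} fps"
  assumes "has_log_deriv E G" "has_log_deriv F G"
  shows "E = F"
proof (rule fps_ext)
  show "E $ n = F $ n" for n
  proof (induction n rule: less_induct)
    case (less n)
    show ?case
    proof (cases "n = 0")
      case False
      have "of_nat n * E $ n = of_nat n * F $ n"
        unfolding has_log_deriv_nth[OF assms(1)] has_log_deriv_nth[OF assms(2)]
        by (rule sum.cong) (use less False in auto)
      thus ?thesis using False by simp
    qed (use assms in \<open>simp add: has_log_deriv_def\<close>)
  qed
qed

lemma has_log_deriv_mult:
  assumes "has_log_deriv E G" "has_log_deriv E' G'"
  shows "has_log_deriv (E * E') (G + G')"
proof -
  have "fps_X * fps_deriv (E * E') = (fps_X * fps_deriv E) * E' + E * (fps_X * fps_deriv E')"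
    by (simp add: algebra_simps)
  also have "\<dots> = (G + G') * (E * E')"
    using assms by (simp add: has_log_deriv_def algebra_simps)
  finally show ?thesis using assms by (simp add: has_log_deriv_def)
qed

definition fps_map :: "('a \<Rightarrow> 'b) \<Rightarrow> 'a fps \<Rightarrow> 'b fps" where
  "fps_map f E = Abs_fps (\<lambda>n. f (E $ n))"

lemma fps_map_nth [simp]: "fps_map f E $ n = f (E $ n)"
  by (simp add: fps_map_def)

lemma (in unital_hom) fps_map_hom: "unital_hom (fps_map f)"
  by standard (auto intro!: fps_ext simp: fps_mult_nth)

lemma has_log_deriv_map:
  assumes "unital_hom f" "has_log_deriv E G"
  shows "has_log_deriv (fps_map f E) (fps_map f G)"
proof -
  interpret unital_hom f by fact
  interpret map: unital_hom "fps_map f" by (rule fps_map_hom)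
  have "fps_X * fps_deriv (fps_map f E) = fps_map f (fps_X * fps_deriv E)"
    by (rule fps_ext) (simp only: fps_X_deriv_nth fps_map_nth hom_mult hom_of_nat)
  also have "fps_X * fps_deriv E = G * E"
    using assms(2) by (simp add: has_log_deriv_def)
  finally show ?thesis using assms(2) by (simp add: has_log_deriv_def)
qed

text \<open>Replacing z by c z commutes with z d/dz.\<close>

lemma has_log_deriv_scale:
  assumes "has_log_deriv E G"
  shows "has_log_deriv (Abs_fps (\<lambda>n. c ^ n * E $ n)) (Abs_fps (\<lambda>n. c ^ n * G $ n))"
proof -
  have "of_nat n * (c ^ n * E $ n) = (\<Sum>i=0..n. c ^ i * G $ i * (c ^ (n - i) * E $ (n - i)))" for n
  proof -
    have "of_nat n * (c ^ n * E $ n) = c ^ n * (\<Sum>i=0..n. G $ i * E $ (n - i))"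
      using assms fps_X_deriv_nth[of E n] by (simp add: has_log_deriv_def fps_mult_nth mult.left_commute)
    also have "\<dots> = (\<Sum>i=0..n. (c ^ i * c ^ (n - i)) * (G $ i * E $ (n - i)))"
      by (simp add: sum_distrib_left flip: power_add)
    finally show ?thesis by (simp add: mult_ac)
  qed
  hence "fps_X * fps_deriv (Abs_fps (\<lambda>n. c ^ n * E $ n))
      = Abs_fps (\<lambda>n. c ^ n * G $ n) * Abs_fps (\<lambda>n. c ^ n * E $ n)"
    by (intro fps_ext, subst fps_X_deriv_nth, subst fps_mult_nth) (simp only: fps_nth_Abs_fps)
  thus ?thesis
    using assms by (simp add: has_log_deriv_def)
qed

definition geom :: "'a::comm_ring_1 \<Rightarrow> 'a fps" where
  "geom c = Abs_fps (\<lambda>n. c ^ n)"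

lemma geom_inverse: "(1 - fps_const c * fps_X) * geom c = 1"
proof (rule fps_ext)
  show "((1 - fps_const c * fps_X) * geom c) $ n = 1 $ n" for n
    by (cases n) (simp_all add: geom_def algebra_simps)
qed

text \<open>This is c z / (1 - c z), up to sign the Euler logarithmic derivative of both 1 - c z and
  its inverse.\<close>

definition geom0 :: "'a::comm_ring_1 \<Rightarrow> 'a fps" where
  "geom0 c = Abs_fps (\<lambda>n. if n = 0 then 0 else c ^ n)"

lemma geom0_eq: "geom0 c = fps_const c * fps_X * geom c"
proof (rule fps_ext)
  show "geom0 c $ n = (fps_const c * fps_X * geom c) $ n" for n
    by (cases n) (simp_all add: geom_def geom0_def mult.assoc)
qed

lemma has_log_deriv_linear: "has_log_deriv (1 - fps_const c * fps_X) (- geom0 c)"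
proof -
  let ?L = "1 - fps_const c * fps_X"
  have "- geom0 c * ?L = - (fps_const c * fps_X * (?L * geom c))"
    by (simp only: geom0_eq mult_minus_left mult_minus_right mult_ac)
  also have "\<dots> = fps_X * fps_deriv ?L"
    unfolding geom_inverse by (simp add: mult.commute flip: fps_const_neg)
  finally show ?thesis by (simp add: has_log_deriv_def geom0_def del: fps_deriv_sub)
qed

lemma has_log_deriv_geom: "has_log_deriv (geom c) (geom0 c)"
proof -
  define L where "L = 1 - fps_const c * fps_X"
  have L: "L * geom c = 1" "fps_X * fps_deriv L = - geom0 c * L"
    using geom_inverse[of c] has_log_deriv_linear[of c] by (simp_all only: L_def has_log_deriv_def)
  have "0 = fps_X * fps_deriv (L * geom c)" by (simp add: L)
  also have "\<dots> = (fps_X * fps_deriv L) * geom c + L * (fps_X * fps_deriv (geom c))"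
    by (simp add: algebra_simps)
  also have "\<dots> = L * (fps_X * fps_deriv (geom c)) - geom0 c * (L * geom c)"
    unfolding L(2) by (simp add: mult.assoc)
  finally have "L * (fps_X * fps_deriv (geom c)) = geom0 c"
    by (simp add: L)
  hence "(L * geom c) * (fps_X * fps_deriv (geom c)) = geom0 c * geom c"
    by (metis mult.assoc mult.commute)
  moreover have "geom c $ 0 = 1" "geom0 c $ 0 = 0"
    by (simp_all add: geom_def geom0_def)
  ultimately show ?thesis by (simp add: L has_log_deriv_def)
qed

lemma has_log_deriv_exp:
  fixes A :: "(expo \<Rightarrow>\<^sub>0 Qq) fps"
  assumes "A $ 0 = 0"
  shows "has_log_deriv (Abs_fps (\<lambda>j. ps_const (1 / fact j)) oo A) (fps_X * fps_deriv A)"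
proof -
  have "of_nat (Suc n) * ps_const (1 / fact (Suc n)) = ps_const (1 / fact n)" for n
    unfolding ps_const.hom_of_nat[symmetric] ps_const.hom_mult[symmetric]
    by (simp add: field_simps del: of_nat_Suc)
  hence "fps_deriv (Abs_fps (\<lambda>j. ps_const (1 / fact j))) = Abs_fps (\<lambda>j. ps_const (1 / fact j))"
    by (intro fps_ext) (simp del: of_nat_Suc fact_Suc)
  thus ?thesis
    using assms by (simp add: has_log_deriv_def fps_compose_deriv mult_ac)
qed

section \<open>Scalars and exponentials in power sum coordinates\<close>

lemma qq_gt_1: "1 < qq"
  by (simp add: qq_def One_fract_def less_fract less_poly_def pos_poly_def one_pCons)


text \<open>\<open>Qq\<close> is an ordered field in which q is larger than every constant, so
  powers of q grow strictly. That q is not a root of unity keeps all later denominators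
  nonzero.\<close>

lemma qq_power_neq_1: "0 < n \<Longrightarrow> qq ^ n \<noteq> 1"
  using one_less_power[OF qq_gt_1, of n] by auto

lemma qq_neq_0 [simp]: "qq \<noteq> 0"
  using qq_gt_1 by auto

lemma tt_neq_0 [simp]: "tt \<noteq> 0"
  by (simp add: tt_def)

lemma tt_power: "tt ^ n = inverse (qq ^ n)"
  by (simp add: tt_def inverse_eq_divide power_one_over)

lemma tt_power_neq_1: "0 < n \<Longrightarrow> tt ^ n \<noteq> 1"
  using qq_power_neq_1[of n] by (simp add: tt_power)

text \<open>This is p_k[M[u]_q]; the denominator 1 - q of the bracket cancels against a factor of
  M.\<close>

definition shift_coeff :: "nat \<Rightarrow> nat \<Rightarrow> Qq" where
  "shift_coeff u k = (1 - tt ^ k) * (1 - qq ^ (u * k))"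

text \<open>This is p_k[-[u]_t].\<close>

definition exp_coeff :: "nat \<Rightarrow> nat \<Rightarrow> Qq" where
  "exp_coeff u k = - ((1 - tt ^ (u * k)) / (1 - tt ^ k))"

definition omega_log_deriv :: "nat \<Rightarrow> (expo \<Rightarrow>\<^sub>0 Qq) fps" where
  "omega_log_deriv u = Abs_fps (\<lambda>k. if k = 0 then 0 else ps_const (exp_coeff u k) * ps_gen k)"

text \<open>\<open>\<Omega>[-z[u]\<^sub>t X]\<close> as a series in \<open>z\<close> over the polynomials in the power sums.\<close>
definition omega_series :: "nat \<Rightarrow> (expo \<Rightarrow>\<^sub>0 Qq) fps" where
  "omega_series u = Abs_fps (\<lambda>j. ps_const (1 / fact j)) oo
     Abs_fps (\<lambda>k. if k = 0 then 0 else ps_const (exp_coeff u k / of_nat k) * ps_gen k)"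

lemma has_log_deriv_omega_series: "has_log_deriv (omega_series u) (omega_log_deriv u)"
proof -
  let ?A = "Abs_fps (\<lambda>k. if k = 0 then 0 else ps_const (exp_coeff u k / of_nat k) * ps_gen k)"
  have "of_nat k * (ps_const (exp_coeff u k / of_nat k) * ps_gen k) = ps_const (exp_coeff u k) * ps_gen k"
    if "0 < k" for k
    using that unfolding ps_const.hom_of_nat[symmetric] mult.assoc[symmetric] ps_const.hom_mult[symmetric]
    by simp
  hence "fps_X * fps_deriv ?A = omega_log_deriv u"
    by (intro fps_ext) (auto simp: fps_X_deriv_nth omega_log_deriv_def)
  thus ?thesis
    using has_log_deriv_exp[of ?A] by (simp add: omega_series_def)
qed

lemma omega_series_add: "omega_series u1 * Abs_fps (\<lambda>n. ps_const (tt ^ u1) ^ n * omega_series u2 $ n) = omega_series (u1 + u2)"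
proof (rule has_log_deriv_unique)
  \<comment> \<open>This is [u1]_t + t^u1 [u2]_t = [u1 + u2]_t with t^k for t. The case
    \<open>d = 0\<close> is k = 0, where division by zero makes both sides 0.\<close>
  have "- ((1 - x) / d) + x * - ((1 - y) / d) = - ((1 - x * y) / d)" for x y d :: Qq
    by (cases "d = 0") (simp_all add: field_simps)
  hence "exp_coeff u1 k + tt ^ (u1 * k) * exp_coeff u2 k = exp_coeff (u1 + u2) k" for k
    unfolding exp_coeff_def distrib_right power_add .
  hence *: "ps_const (exp_coeff u1 k) + ps_const (tt ^ u1) ^ k * ps_const (exp_coeff u2 k)
      = ps_const (exp_coeff (u1 + u2) k)" if "0 < k" for k
    using that unfolding ps_const.hom_power[symmetric] ps_const.hom_mult[symmetric] ps_const.hom_add[symmetric]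
    by (simp add: power_mult)
  have omega_log_deriv: "omega_log_deriv u1 + Abs_fps (\<lambda>n. ps_const (tt ^ u1) ^ n * omega_log_deriv u2 $ n) = omega_log_deriv (u1 + u2)"
  proof (rule fps_ext)
    show "(omega_log_deriv u1 + Abs_fps (\<lambda>n. ps_const (tt ^ u1) ^ n * omega_log_deriv u2 $ n)) $ n = omega_log_deriv (u1 + u2) $ n" for n
      using *[of n] by (cases "n = 0") (simp_all add: omega_log_deriv_def flip: distrib_right mult.assoc)
  qed
  show "has_log_deriv (omega_series u1 * Abs_fps (\<lambda>n. ps_const (tt ^ u1) ^ n * omega_series u2 $ n)) (omega_log_deriv (u1 + u2))"
    unfolding omega_log_deriv[symmetric] by (intro has_log_deriv_mult has_log_deriv_omega_series has_log_deriv_scale)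
qed (rule has_log_deriv_omega_series)

text \<open>The substitution \<open>X \<mapsto> X + M[u]\<^sub>q y\<close>, where the polynomial variable \<open>y\<close> stands for \<open>1/z\<close>.\<close>
definition shift_hom :: "nat \<Rightarrow> (expo \<Rightarrow>\<^sub>0 Qq) \<Rightarrow> (expo \<Rightarrow>\<^sub>0 Qq) poly" where
  "shift_hom u = ps_subst (\<lambda>c. [:ps_const c:]) (\<lambda>k. [:ps_gen k:] + monom (ps_const (shift_coeff u k)) k)"

lemma unital_hom_const_poly: "unital_hom (\<lambda>c. [:c:])"
  by standard (auto simp: one_pCons)

lemma unital_hom_ps_const_poly: "unital_hom (\<lambda>c. [:ps_const c:])"
  by (intro unital_hom_comp[OF unital_hom_const_poly] ps_const.unital_hom_axioms)

interpretation shift_hom: unital_hom "shift_hom u"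
  unfolding shift_hom_def by (rule unital_hom_ps_subst) (rule unital_hom_ps_const_poly)

lemma shift_hom_const [simp]: "shift_hom u (ps_const c) = [:ps_const c:]"
  unfolding shift_hom_def by (rule ps_subst_const) (rule unital_hom_ps_const_poly)

lemma shift_hom_gen: "0 < k \<Longrightarrow> shift_hom u (ps_gen k) = [:ps_gen k:] + monom (ps_const (shift_coeff u k)) k"
  unfolding shift_hom_def by (rule ps_subst_gen) (rule unital_hom_ps_const_poly)

text \<open>\<open>\<Omega>[-w (1 - t\<^bsup>u2\<^esup>)(1 - q\<^bsup>u1\<^esup>)]\<close> as a series in \<open>w\<close>.\<close>
definition cross_series :: "nat \<Rightarrow> nat \<Rightarrow> Qq fps" where
  "cross_series u1 u2 = (1 - fps_const 1 * fps_X) * (1 - fps_const (qq ^ u1 * tt ^ u2) * fps_X)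
     * (geom (qq ^ u1) * geom (tt ^ u2))"

text \<open>The factor 1 - t^k cancels in the product of the two coefficients. Expanding what is
  left gives four k-th powers, one for each linear factor of \<open>cross_series\<close>.\<close>

lemma has_log_deriv_cross_series:
  "has_log_deriv (cross_series u1 u2) (Abs_fps (\<lambda>k. if k = 0 then 0 else exp_coeff u2 k * shift_coeff u1 k))"
proof -
  have *: "exp_coeff u2 k * shift_coeff u1 k
      = - 1 - (qq ^ u1 * tt ^ u2) ^ k + ((qq ^ u1) ^ k + (tt ^ u2) ^ k)" if "0 < k" for k
    using tt_power_neq_1[OF that]
    by (simp add: exp_coeff_def shift_coeff_def field_simps flip: power_mult)
  have eq: "- geom0 1 + - geom0 (qq ^ u1 * tt ^ u2) + (geom0 (qq ^ u1) + geom0 (tt ^ u2))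
      = Abs_fps (\<lambda>k. if k = 0 then 0 else exp_coeff u2 k * shift_coeff u1 k)"
    by (rule fps_ext) (use * in \<open>auto simp: geom0_def\<close>)
  show ?thesis
    unfolding cross_series_def eq[symmetric]
    by (intro has_log_deriv_mult has_log_deriv_linear has_log_deriv_geom)
qed

text \<open>The partial fraction constant of \<open>cross_series\<close>. Written in q alone it is
  symmetric in u1 and u2, so both orders of composition share it.\<close>

definition cross_factor :: "nat \<Rightarrow> nat \<Rightarrow> Qq" where
  "cross_factor u1 u2 = - ((1 - qq ^ u1) * (1 - qq ^ u2) / (1 - qq ^ (u1 + u2)))"

lemma cross_factor_commute: "cross_factor u1 u2 = cross_factor u2 u1"
  by (simp add: cross_factor_def mult.commute add.commute)

text \<open>Partial fractions: with a = q^u1 and b = t^u2, numerator minus denominator is (a + b - 1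
  - a b) w, which equals A ((1 - b w) - (1 - a w)).\<close>

lemma cross_series_nth:
  assumes "0 < u1 + u2"
  shows "cross_series u1 u2 $ s = (if s = 0 then 1 else 0)
    + cross_factor u1 u2 * ((qq ^ u1) ^ s - (tt ^ u2) ^ s)"
proof -
  define a b A where "a = qq ^ u1" and "b = tt ^ u2" and "A = cross_factor u1 u2"
  let ?La = "1 - fps_const a * fps_X" and ?Lb = "1 - fps_const b * fps_X"
  have "qq ^ (u1 + u2) \<noteq> 1" using qq_power_neq_1[OF assms] .
  hence "A * (a - b) = a + b - 1 - a * b"
    by (simp add: A_def cross_factor_def a_def b_def tt_power divide_simps)
       (simp add: power_add algebra_simps)
  hence A: "fps_const A * (fps_const a - fps_const b) = fps_const a + fps_const b - 1 - fps_const a * fps_const b"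
    by (simp flip: fps_const_1_eq_1)
  have "(1 - fps_const 1 * fps_X) * (1 - fps_const (a * b) * fps_X) - ?La * ?Lb
      = (fps_const a + fps_const b - 1 - fps_const a * fps_const b) * fps_X"
    by (simp add: algebra_simps flip: fps_const_mult)
  also have "\<dots> = fps_const A * (?Lb - ?La)"
    unfolding A[symmetric] by (simp add: algebra_simps)
  finally have "(1 - fps_const 1 * fps_X) * (1 - fps_const (a * b) * fps_X) = ?La * ?Lb + fps_const A * (?Lb - ?La)"
    by (simp add: algebra_simps)
  hence "cross_series u1 u2 = (?La * ?Lb + fps_const A * (?Lb - ?La)) * (geom a * geom b)"
    by (simp add: cross_series_def a_def b_def)
  also have "\<dots> = (?La * geom a) * (?Lb * geom b) + fps_const A * ((?Lb * geom b) * geom a - (?La * geom a) * geom b)"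
    by (simp only: algebra_simps)
  also have "\<dots> = 1 + fps_const A * (geom a - geom b)"
    by (simp only: geom_inverse mult_1)
  finally show ?thesis
    by (simp add: geom_def a_def b_def A_def)
qed

text \<open>On logarithmic derivatives the shift only adds a multiple of y^k to each p_k. The added
  part belongs to \<open>cross_series\<close> at w = y z, so the exponential picks up exactly this
  factor.\<close>

lemma shift_hom_omega_series:
  "shift_hom u1 (omega_series u2 $ n) = (\<Sum>s\<le>n. monom (ps_const (cross_series u1 u2 $ s) * omega_series u2 $ (n - s)) s)"
proof -
  let ?y = "monom 1 1 :: (expo \<Rightarrow>\<^sub>0 Qq) poly"
  define H where "H = Abs_fps (\<lambda>s. ?y ^ s * fps_map (\<lambda>c. [:ps_const c:]) (cross_series u1 u2) $ s)"
  define HG where "HG = Abs_fps (\<lambda>k. ?y ^ k * fps_map (\<lambda>c. [:ps_const c:])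
    (Abs_fps (\<lambda>k. if k = 0 then 0 else exp_coeff u2 k * shift_coeff u1 k)) $ k)"
  have H: "has_log_deriv H HG"
    unfolding H_def HG_def
    by (intro has_log_deriv_scale has_log_deriv_map unital_hom_ps_const_poly has_log_deriv_cross_series)
  have "fps_map (shift_hom u1) (omega_log_deriv u2) = fps_map (\<lambda>c. [:c:]) (omega_log_deriv u2) + HG"
    by (rule fps_ext)
      (auto simp: HG_def omega_log_deriv_def shift_hom_gen monom_power ring_distribs smult_monom mult_ac)
  hence "has_log_deriv (fps_map (shift_hom u1) (omega_series u2)) (fps_map (\<lambda>c. [:c:]) (omega_log_deriv u2) + HG)"
    using has_log_deriv_map[OF shift_hom.unital_hom_axioms has_log_deriv_omega_series] by metis
  hence "fps_map (shift_hom u1) (omega_series u2) = fps_map (\<lambda>c. [:c:]) (omega_series u2) * H"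
    by (rule has_log_deriv_unique)
      (intro has_log_deriv_mult has_log_deriv_map unital_hom_const_poly has_log_deriv_omega_series H)
  hence "shift_hom u1 (omega_series u2 $ n) = (H * fps_map (\<lambda>c. [:c:]) (omega_series u2)) $ n"
    by (metis fps_map_nth mult.commute)
  also have "\<dots> = (\<Sum>s\<le>n. monom (ps_const (cross_series u1 u2 $ s) * omega_series u2 $ (n - s)) s)"
    unfolding fps_mult_nth atLeast0AtMost
    by (intro sum.cong) (simp_all add: H_def monom_power smult_monom mult_ac)
  finally show ?thesis .
qed

section \<open>The commutator of two operators D\<close>

text \<open>\<open>diag_coeff E v f\<close> is the coefficient of \<open>z\<^sup>v\<close> in \<open>f(1/z) E(z)\<close>.\<close>
definition diag_coeff :: "'a::comm_ring_1 fps \<Rightarrow> nat \<Rightarrow> 'a poly \<Rightarrow> 'a" where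
  "diag_coeff E v f = (\<Sum>i\<le>degree f. coeff f i * E $ (v + i))"

lemma diag_coeff_bound:
  assumes "degree f \<le> N"
  shows "diag_coeff E v f = (\<Sum>i\<le>N. coeff f i * E $ (v + i))"
  unfolding diag_coeff_def
  by (rule sum.mono_neutral_left) (use assms in \<open>auto simp: not_le coeff_eq_0\<close>)

lemma diag_coeff_add: "diag_coeff E v (f + g) = diag_coeff E v f + diag_coeff E v g"
proof -
  define N where "N = max (degree f) (degree g)"
  have "degree f \<le> N" "degree g \<le> N" "degree (f + g) \<le> N"
    by (auto simp: N_def degree_add_le_max)
  thus ?thesis by (simp add: diag_coeff_bound ring_distribs sum.distrib)
qed

lemma diag_coeff_sum: "diag_coeff E v (sum g A) = (\<Sum>x\<in>A. diag_coeff E v (g x))"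
  by (induction A rule: infinite_finite_induct) (simp_all add: diag_coeff_add, simp_all add: diag_coeff_def)

lemma diag_coeff_monom: "diag_coeff E v (monom c i) = c * E $ (v + i)"
  by (subst diag_coeff_bound[of _ i]) (simp_all add: degree_monom_le mult_delta_left sum.delta')

text \<open>Multiplication by y^s = z^(-s) moves the extracted coefficient from v to v + s.\<close>

lemma diag_coeff_monom_mult: "diag_coeff E v (monom c s * f) = c * diag_coeff E (v + s) f"
proof -
  have "diag_coeff E v (monom c s * f) = diag_coeff E v (monom c s * (\<Sum>i\<le>degree f. monom (coeff f i) i))"
    by (simp add: poly_as_sum_of_monoms)
  also have "\<dots> = (\<Sum>i\<le>degree f. c * coeff f i * E $ (v + (s + i)))"
    by (simp add: sum_distrib_left diag_coeff_sum mult_monom diag_coeff_monom)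
  also have "\<dots> = c * diag_coeff E (v + s) f"
    by (simp add: diag_coeff_def sum_distrib_left mult_ac add_ac)
  finally show ?thesis .
qed

definition D_poly :: "nat \<Rightarrow> nat \<Rightarrow> (expo \<Rightarrow>\<^sub>0 Qq) \<Rightarrow> expo \<Rightarrow>\<^sub>0 Qq" where
  "D_poly u v P = diag_coeff (omega_series u) v (shift_hom u P)"

text \<open>The coefficient of y1^i y2^j in P[X + M[u1]_q y1 + M[u2]_q y2], an expression in which
  the two shifts play the same role.\<close>

definition double_shift :: "nat \<Rightarrow> nat \<Rightarrow> nat \<Rightarrow> nat \<Rightarrow> (expo \<Rightarrow>\<^sub>0 Qq) \<Rightarrow> expo \<Rightarrow>\<^sub>0 Qq" where
  "double_shift u1 u2 i j P = coeff (shift_hom u1 (coeff (shift_hom u2 P) j)) i"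

lemma double_shift_mult:
  "double_shift u1 u2 i j (P * Q) = (\<Sum>a\<le>i. \<Sum>b\<le>j. double_shift u1 u2 a b P * double_shift u1 u2 (i - a) (j - b) Q)"
proof -
  have "double_shift u1 u2 i j (P * Q) = (\<Sum>b\<le>j. \<Sum>a\<le>i. double_shift u1 u2 a b P * double_shift u1 u2 (i - a) (j - b) Q)"
    by (simp add: double_shift_def coeff_mult coeff_sum)
  thus ?thesis by (subst sum.swap)
qed

lemma double_shift_commute: "double_shift u1 u2 i j P = double_shift u2 u1 j i P"
proof (induction P arbitrary: i j rule: ps_poly_induct)
  case (const c)
  show ?case by (simp add: double_shift_def coeff_pCons split: nat.split)
next
  case (gen k)
  thus ?case by (auto simp: double_shift_def shift_hom_gen coeff_pCons split: nat.splits)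
next
  case (add P Q)
  thus ?case by (simp add: double_shift_def)
next
  case (mult P Q)
  show ?case unfolding double_shift_mult by (subst sum.swap) (simp add: mult.IH)
qed

text \<open>The variable y2 of the shift by u2 is specialised to q^u1 y1. This is the restriction to
  the pole w = q^(-u1), where the two shifts merge.\<close>

lemma shift_hom_add_poly:
  "shift_hom (u1 + u2) P = poly (map_poly (shift_hom u1) (shift_hom u2 P)) (monom (ps_const (qq ^ u1)) 1)"
proof (rule hom_eqI[where f = "shift_hom (u1 + u2)"
      and g = "\<lambda>P. poly (map_poly (shift_hom u1) (shift_hom u2 P)) (monom (ps_const (qq ^ u1)) 1)"])
  show "unital_hom (\<lambda>P. poly (map_poly (shift_hom u1) (shift_hom u2 P)) (monom (ps_const (qq ^ u1)) 1))"
    by (intro unital_hom_comp[OF unital_hom_poly] unital_hom_comp[OF shift_hom.map_poly_hom] shift_hom.unital_hom_axioms)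
  fix k :: nat assume k: "0 < k"
  have "shift_coeff (u1 + u2) k = shift_coeff u1 k + shift_coeff u2 k * (qq ^ u1) ^ k"
    by (simp add: shift_coeff_def power_add algebra_simps flip: power_mult)
  thus "shift_hom (u1 + u2) (ps_gen k) = poly (map_poly (shift_hom u1) (shift_hom u2 (ps_gen k))) (monom (ps_const (qq ^ u1)) 1)"
    using k by (simp add: shift_hom_gen map_poly_pCons unital_hom.hom_add[OF shift_hom.map_poly_hom] map_poly_monom
        poly_monom monom_power smult_monom flip: ps_const.hom_power ps_const.hom_mult add_monom)
qed (simp_all add: shift_hom.unital_hom_axioms map_poly_pCons)

lemma shift_hom_add:
  assumes "degree (shift_hom u2 P) \<le> N"
  shows "shift_hom (u1 + u2) P = (\<Sum>j\<le>N. monom (ps_const (qq ^ (u1 * j))) j * shift_hom u1 (coeff (shift_hom u2 P) j))"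
proof -
  define p where "p = map_poly (shift_hom u1) (shift_hom u2 P)"
  have "degree p \<le> N"
    unfolding p_def using assms map_poly_degree_leq[of "shift_hom u1" "shift_hom u2 P"] by simp
  hence "poly p x = (\<Sum>j\<le>N. coeff p j * x ^ j)" for x
    unfolding poly_altdef
    by (intro sum.mono_neutral_left) (auto simp: not_le coeff_eq_0)
  thus ?thesis
    unfolding shift_hom_add_poly p_def[symmetric]
    by (simp add: p_def coeff_map_poly monom_power power_mult mult.commute[of "shift_hom u1 _"])
qed

text \<open>A delta function in coefficients: the three pieces are the ranges r < b, r = b and r > b
  of one convolution, reached by r = b - s and r = b + s. The ranges are finite because
  \<open>f\<close> and \<open>g\<close> have no negative indices.\<close>

lemma convolution_shift:
  fixes f g :: "nat \<Rightarrow> 'a::comm_ring_1"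
  assumes c: "c * c' = 1"
  shows "(\<Sum>s=1..b. c ^ s * f (a + s) * g (b - s)) + f a * g b + (\<Sum>s=1..a. c' ^ s * f (a - s) * g (b + s))
    = c ^ b * (\<Sum>r\<le>a + b. c' ^ r * g r * f (a + b - r))"
proof -
  have cc: "c ^ s * c' ^ s = 1" for s
    using c by (simp flip: power_mult_distrib)
  define F where "F r = c ^ b * (c' ^ r * g r * f (a + b - r))" for r
  have split: "{..a + b} = {..<b} \<union> {b} \<union> {b + 1..b + a}" by auto
  have "(\<Sum>r\<le>a + b. F r) = (\<Sum>r<b. F r) + F b + (\<Sum>r=b + 1..b + a. F r)"
    unfolding split by (subst sum.union_disjoint; auto)+
  also have "(\<Sum>r<b. F r) = (\<Sum>s=1..b. c ^ s * f (a + s) * g (b - s))"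
  proof (rule sum.reindex_bij_witness[of _ "\<lambda>s. b - s" "\<lambda>r. b - r"])
    fix r assume "r \<in> {..<b}"
    hence "c ^ b = c ^ (b - r) * c ^ r" "a + b - r = a + (b - r)"
      by (simp_all flip: power_add)
    thus "c ^ (b - r) * f (a + (b - r)) * g (b - (b - r)) = F r"
      using \<open>r \<in> {..<b}\<close> cc[of r] unfolding F_def
      by (metis (no_types, lifting) diff_diff_cancel lessThan_iff less_imp_le mult.assoc mult.commute mult_1)
  qed auto
  also have "(\<Sum>r=b + 1..b + a. F r) = (\<Sum>s=1..a. c' ^ s * f (a - s) * g (b + s))"
  proof (rule sum.reindex_bij_witness[of _ "\<lambda>s. b + s" "\<lambda>r. r - b"])
    fix r assume r: "r \<in> {b + 1..b + a}"
    then obtain s where s: "r = b + s" using le_Suc_ex[of b r] by auto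
    show "c' ^ (r - b) * f (a - (r - b)) * g (b + (r - b)) = F r"
      using cc[of b] by (simp add: s F_def power_add mult_ac flip: mult.assoc[of "c ^ b"])
  qed auto
  also have "F b = f a * g b"
    using cc[of b] by (simp add: F_def mult_ac flip: mult.assoc[of "c ^ b"])
  finally show ?thesis by (simp add: F_def sum_distrib_left)
qed

lemma omega_series_add_nth:
  "(\<Sum>r\<le>n. ps_const (tt ^ u1) ^ r * omega_series u2 $ r * omega_series u1 $ (n - r)) = omega_series (u1 + u2) $ n"
proof -
  have "omega_series (u1 + u2) $ n = (Abs_fps (\<lambda>n. ps_const (tt ^ u1) ^ n * omega_series u2 $ n) * omega_series u1) $ n"
    unfolding omega_series_add[symmetric] by (subst mult.commute) (rule refl)
  thus ?thesis by (simp add: fps_mult_nth atLeast0AtMost)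
qed

text \<open>The coefficient of one term of the double shift in the commutator, with a = v1 + i and b
  = v2 + j. The powers q^(u1 b) and q^(u2 a) are the prefactors produced by
  \<open>convolution_shift\<close> at the two poles.\<close>

lemma cross_commutator:
  assumes "0 < u1" "0 < u2"
  shows "(\<Sum>s\<le>b. ps_const (cross_series u1 u2 $ s) * omega_series u2 $ (b - s) * omega_series u1 $ (a + s)) -
    (\<Sum>s\<le>a. ps_const (cross_series u2 u1 $ s) * omega_series u1 $ (a - s) * omega_series u2 $ (b + s)) =
    ps_const (cross_factor u1 u2 * (qq ^ (u1 * b) - qq ^ (u2 * a))) * omega_series (u1 + u2) $ (a + b)"
proof -
  define A al be al' be' where "A = ps_const (cross_factor u1 u2)"
    and "al = ps_const (qq ^ u1)" and "be = ps_const (tt ^ u2)"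
    and "al' = ps_const (tt ^ u1)" and "be' = ps_const (qq ^ u2)"
  have inv: "al * al' = 1" "be' * be = 1"
    by (simp_all add: al_def al'_def be_def be'_def tt_power del: ps_const.hom_power flip: ps_const.hom_mult)
  define X where "X c = (\<Sum>s=1..b. c ^ s * omega_series u1 $ (a + s) * omega_series u2 $ (b - s))" for c
  define Y where "Y c = (\<Sum>s=1..a. c ^ s * omega_series u1 $ (a - s) * omega_series u2 $ (b + s))" for c
  define Z where "Z = omega_series u1 $ a * omega_series u2 $ b"
  have atMost: "{..n} = insert 0 {1..n}" for n :: nat by auto
  have 1: "ps_const (cross_series u1 u2 $ s) = (if s = 0 then 1 else 0) + A * (al ^ s - be ^ s)" for s
    using assms by (simp add: cross_series_nth A_def al_def be_def flip: ps_const.hom_power)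
  have 2: "ps_const (cross_series u2 u1 $ s) = (if s = 0 then 1 else 0) + A * (be' ^ s - al' ^ s)" for s
    using assms by (simp add: cross_series_nth A_def al'_def be'_def cross_factor_commute[of u2] flip: ps_const.hom_power)
  have 3: "(\<Sum>s\<le>b. ps_const (cross_series u1 u2 $ s) * omega_series u2 $ (b - s) * omega_series u1 $ (a + s)) = Z + A * (X al - X be)"
    unfolding X_def Z_def sum_subtractf[symmetric] sum_distrib_left atMost 1
    by (simp add: algebra_simps)
  have 4: "(\<Sum>s\<le>a. ps_const (cross_series u2 u1 $ s) * omega_series u1 $ (a - s) * omega_series u2 $ (b + s)) = Z + A * (Y be' - Y al')"
    unfolding Y_def Z_def sum_subtractf[symmetric] sum_distrib_left atMost 2
    by (simp add: algebra_simps)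
  have 5: "X al + Z + Y al' = al ^ b * omega_series (u1 + u2) $ (a + b)"
    unfolding X_def Y_def Z_def
    using convolution_shift[OF inv(1), where f = "fps_nth (omega_series u1)" and g = "fps_nth (omega_series u2)" and a = a and b = b]
    unfolding al'_def omega_series_add_nth by simp
  have 6: "Y be' + Z + X be = be' ^ a * omega_series (u1 + u2) $ (a + b)"
    unfolding X_def Y_def Z_def
    using convolution_shift[OF inv(2), where f = "fps_nth (omega_series u2)" and g = "fps_nth (omega_series u1)" and a = b and b = a]
    unfolding be_def omega_series_add_nth by (simp add: mult_ac add_ac)
  \<comment> \<open>Terms are regrouped by pole: a ratio from one order of composition is paired
    with its inverse from the other. The copies of \<open>Z\<close> cancel and supply the missing
    middle terms.\<close>
  have "(\<Sum>s\<le>b. ps_const (cross_series u1 u2 $ s) * omega_series u2 $ (b - s) * omega_series u1 $ (a + s)) -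
    (\<Sum>s\<le>a. ps_const (cross_series u2 u1 $ s) * omega_series u1 $ (a - s) * omega_series u2 $ (b + s))
    = A * ((X al + Z + Y al') - (Y be' + Z + X be))"
    unfolding 3 4 by (simp add: algebra_simps)
  also have "\<dots> = A * (al ^ b * omega_series (u1 + u2) $ (a + b) - be' ^ a * omega_series (u1 + u2) $ (a + b))"
    unfolding 5 6 ..
  also have "\<dots> = ps_const (cross_factor u1 u2 * (qq ^ (u1 * b) - qq ^ (u2 * a))) * omega_series (u1 + u2) $ (a + b)"
    by (simp add: A_def al_def be'_def power_mult left_diff_distrib right_diff_distrib mult.assoc)
  finally show ?thesis .
qed

text \<open>A bound uniform in \<open>j\<close> lets the double sums run over a fixed square, so
  that their order can be exchanged.\<close>

lemma degree_shift_hom_coeff_bound: "\<exists>N. \<forall>j. degree (shift_hom u (coeff f j)) \<le> N"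
proof (intro exI allI)
  fix j
  show "degree (shift_hom u (coeff f j)) \<le> Max ((\<lambda>j. degree (shift_hom u (coeff f j))) ` {..degree f})"
  proof (cases "j \<le> degree f")
    case False
    thus ?thesis by (simp add: coeff_eq_0)
  qed simp
qed

lemma D_poly_D_poly:
  assumes "degree (shift_hom u2 P) \<le> N" "\<And>j. degree (shift_hom u1 (coeff (shift_hom u2 P) j)) \<le> N"
  shows "D_poly u1 v1 (D_poly u2 v2 P) = (\<Sum>j\<le>N. \<Sum>i\<le>N. double_shift u1 u2 i j P *
    (\<Sum>s\<le>v2 + j. ps_const (cross_series u1 u2 $ s) * omega_series u2 $ (v2 + j - s) * omega_series u1 $ (v1 + i + s)))"
proof -
  have "shift_hom u1 (D_poly u2 v2 P) = (\<Sum>j\<le>N. \<Sum>s\<le>v2 + j.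
      monom (ps_const (cross_series u1 u2 $ s) * omega_series u2 $ (v2 + j - s)) s * shift_hom u1 (coeff (shift_hom u2 P) j))"
    by (simp add: D_poly_def diag_coeff_bound[OF assms(1)] shift_hom_omega_series sum_distrib_left mult.commute[of "shift_hom u1 _"])
  hence "D_poly u1 v1 (D_poly u2 v2 P) = (\<Sum>j\<le>N. \<Sum>s\<le>v2 + j. \<Sum>i\<le>N. double_shift u1 u2 i j P *
      (ps_const (cross_series u1 u2 $ s) * omega_series u2 $ (v2 + j - s) * omega_series u1 $ (v1 + i + s)))"
    by (simp add: D_poly_def[of u1] diag_coeff_sum diag_coeff_monom_mult diag_coeff_bound[OF assms(2)] double_shift_def
        sum_distrib_left) (simp add: mult_ac add_ac)
  thus ?thesis
    by (subst (asm) sum.swap) (simp add: sum_distrib_left)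
qed

lemma D_poly_add:
  assumes "degree (shift_hom u2 P) \<le> N" "\<And>j. degree (shift_hom u1 (coeff (shift_hom u2 P) j)) \<le> N"
  shows "D_poly (u1 + u2) v P =
    (\<Sum>j\<le>N. \<Sum>i\<le>N. double_shift u1 u2 i j P * (ps_const (qq ^ (u1 * j)) * omega_series (u1 + u2) $ (v + i + j)))"
  by (simp add: D_poly_def shift_hom_add[OF assms(1)] diag_coeff_sum diag_coeff_monom_mult diag_coeff_bound[OF assms(2)] double_shift_def
        sum_distrib_left) (simp add: mult_ac add_ac)

lemma D_poly_commutator:
  assumes "0 < u1" "0 < u2"
  shows "D_poly u1 v1 (D_poly u2 v2 P) - D_poly u2 v2 (D_poly u1 v1 P) =
    ps_const (cross_factor u1 u2 * (qq ^ (u1 * v2) - qq ^ (u2 * v1))) * D_poly (u1 + u2) (v1 + v2) P"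
proof -
  obtain N1 N2 where N12: "\<And>j. degree (shift_hom u1 (coeff (shift_hom u2 P) j)) \<le> N1"
      "\<And>j. degree (shift_hom u2 (coeff (shift_hom u1 P) j)) \<le> N2"
    using degree_shift_hom_coeff_bound by metis
  define N where "N = max (max N1 N2) (max (degree (shift_hom u1 P)) (degree (shift_hom u2 P)))"
  have N: "degree (shift_hom u2 P) \<le> N" "\<And>j. degree (shift_hom u1 (coeff (shift_hom u2 P) j)) \<le> N"
      "degree (shift_hom u1 P) \<le> N" "\<And>j. degree (shift_hom u2 (coeff (shift_hom u1 P) j)) \<le> N"
    using N12 by (auto simp: N_def le_max_iff_disj)
  let ?E = "omega_series (u1 + u2)"
  \<comment> \<open>The operator at (u1 + u2, v1 + v2) has two expansions: splitting the shift with
    u1 first weights the terms by q^(u1 j), with u2 first by q^(u2 i). The two powers of q in the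
    commutator match one expansion each; this is the second.\<close>
  have D3: "D_poly (u1 + u2) (v1 + v2) P = (\<Sum>j\<le>N. \<Sum>i\<le>N. double_shift u1 u2 i j P *
        (ps_const (qq ^ (u2 * i)) * ?E $ (v1 + v2 + i + j)))"
    using D_poly_add[OF N(3,4), of "v1 + v2"]
    by (subst sum.swap) (simp add: double_shift_commute[of u1 u2] add_ac)
  have "D_poly u1 v1 (D_poly u2 v2 P) - D_poly u2 v2 (D_poly u1 v1 P) =
    (\<Sum>j\<le>N. \<Sum>i\<le>N. double_shift u1 u2 i j P *
      ((\<Sum>s\<le>v2 + j. ps_const (cross_series u1 u2 $ s) * omega_series u2 $ (v2 + j - s) * omega_series u1 $ (v1 + i + s)) -
       (\<Sum>s\<le>v1 + i. ps_const (cross_series u2 u1 $ s) * omega_series u1 $ (v1 + i - s) * omega_series u2 $ (v2 + j + s))))"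
    unfolding D_poly_D_poly[OF N(1,2)] D_poly_D_poly[OF N(3,4)]
    by (subst (2) sum.swap) (simp add: double_shift_commute[of u2 u1] right_diff_distrib sum_subtractf)
  also have "\<dots> = (\<Sum>j\<le>N. \<Sum>i\<le>N. double_shift u1 u2 i j P *
      (ps_const (cross_factor u1 u2 * (qq ^ (u1 * (v2 + j)) - qq ^ (u2 * (v1 + i)))) * ?E $ (v1 + v2 + i + j)))"
    by (simp only: cross_commutator[OF assms]) (simp only: add_ac)
  also have "\<dots> = (\<Sum>j\<le>N. \<Sum>i\<le>N.
       ps_const (cross_factor u1 u2 * qq ^ (u1 * v2)) * (double_shift u1 u2 i j P * (ps_const (qq ^ (u1 * j)) * ?E $ (v1 + v2 + i + j)))
     - ps_const (cross_factor u1 u2 * qq ^ (u2 * v1)) * (double_shift u1 u2 i j P * (ps_const (qq ^ (u2 * i)) * ?E $ (v1 + v2 + i + j))))"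
    by (intro sum.cong refl) (simp add: distrib_left power_add algebra_simps)
  also have "\<dots> = ps_const (cross_factor u1 u2 * qq ^ (u1 * v2)) * D_poly (u1 + u2) (v1 + v2) P
      - ps_const (cross_factor u1 u2 * qq ^ (u2 * v1)) * D_poly (u1 + u2) (v1 + v2) P"
    unfolding sum_subtractf sum_distrib_left[symmetric] D3[symmetric]
    unfolding D_poly_add[OF N(1,2), symmetric] ..
  finally show ?thesis
    by (simp add: algebra_simps)
qed

section \<open>Identification with the plethystic definitions\<close>

lemma unital_hom_divide:
  fixes f :: "'a::field \<Rightarrow> 'b::field"
  assumes "unital_hom f"
  shows "f (x / y) = f x / f y"
proof (cases "y = 0")
  case False
  interpret unital_hom f by fact
  have "f (x / y) * f y = f x" "f y * f (1 / y) = 1"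
    using False by (simp_all flip: hom_mult)
  thus ?thesis by (metis eq_divide_eq mult_zero_left zero_neq_one)
qed (simp add: unital_hom.hom_zero[OF assms])

lemma pk_q_qq:
  assumes "0 < k"
  shows "pk_q k qq = qq ^ k"
proof -
  have "qq ^ k = Fract (monom 1 k) 1"
    by (induction k) (simp_all add: qq_def One_fract_def monom_Suc mult_monom)
  moreover have "pk_q k qq = Fract (monom 1 k) 1"
    using pk_q_Fract[OF assms, of 1 "[:0, 1:]"] by (simp add: qq_def pcompose_pCons pcompose_1)
  ultimately show ?thesis by simp
qed

lemma pk_q_tt:
  assumes "0 < k"
  shows "pk_q k tt = tt ^ k"
proof -
  interpret unital_hom "pk_q k" using assms by (rule unital_hom_pk_q)
  show ?thesis
    using unital_hom_divide[OF unital_hom_axioms] by (simp add: tt_def pk_q_qq assms power_one_over)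
qed

lemma brk_int: "brk x (int u) = (1 - x ^ u) / (1 - x)"
  by (simp add: brk_def)

lemma pk_q_shift:
  assumes "0 < k"
  shows "pk_q k (MM * brk qq (int u)) = shift_coeff u k"
proof -
  interpret unital_hom "pk_q k" using assms by (rule unital_hom_pk_q)
  have "MM * brk qq (int u) = (1 - tt) * (1 - qq ^ u)"
    using qq_gt_1 by (simp add: MM_def brk_int)
  thus ?thesis
    by (simp add: pk_q_qq pk_q_tt assms shift_coeff_def mult.commute flip: power_mult)
qed

lemma pk_q_exp:
  assumes "0 < k"
  shows "pk_q k (- brk tt (int u)) = exp_coeff u k"
proof -
  interpret unital_hom "pk_q k" using assms by (rule unital_hom_pk_q)
  show ?thesis
    using unital_hom_divide[OF unital_hom_axioms]
    by (simp add: brk_int pk_q_tt assms exp_coeff_def mult.commute flip: power_mult)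
qed

lemma unital_hom_fls_const: "unital_hom fls_const"
  by standard (simp_all add: fls_plus_const fls_const_mult_const)

lemma dvd_div_eq_iff: "0 < k \<Longrightarrow> int k dvd n \<and> n div int k = c \<longleftrightarrow> n = int k * c"
  by auto

lemma pk_shift:
  assumes k: "0 < k"
  shows "pk k (fls_const XX + fls_const (mps_const c) * fls_X_inv)
    = fls_const (psum k) + fls_const (mps_const (pk_q k c)) * fls_X_inv ^ k"
proof (rule fls_eqI)
  fix n
  let ?E = "fls_const XX + fls_const (mps_const c) * fls_X_inv"
  have E: "?E $$ i = (if i = 0 then XX else if i = -1 then mps_const c else 0)" for i
    by simp
  have div: "- int k div int k = - 1"
    using dvd_div_eq_iff[OF k, of "- int k" "-1"] by simp
  \<comment> \<open>\<open>fls_compose_power\<close> replaces z by z^k, so the exponents 0 and -1 of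
    E become 0 and -k.\<close>
  consider "n = 0" | "n = - int k" | "n \<noteq> 0" "n \<noteq> - int k" by blast
  thus "pk k ?E $$ n = (fls_const (psum k) + fls_const (mps_const (pk_q k c)) * fls_X_inv ^ k) $$ n"
  proof cases
    case 3
    hence "fls_compose_power ?E k $$ n = 0"
      using k dvd_div_eq_iff[OF k, of n 0] dvd_div_eq_iff[OF k, of n "-1"]
      unfolding fls_nth_compose_power[OF k] E by auto
    thus ?thesis using 3 k by (simp add: pk_nth)
  qed (use k in \<open>simp_all add: pk_nth fls_nth_compose_power pk_mps_const div\<close>)
qed

definition laurent :: "(expo \<Rightarrow>\<^sub>0 Qq) poly \<Rightarrow> Qq mps fls" where
  "laurent f = poly (map_poly (\<lambda>c. fls_const (realize c)) f) fls_X_inv"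

lemma unital_hom_const_realize: "unital_hom (\<lambda>c. fls_const (realize c))"
  by (intro unital_hom_comp[OF unital_hom_fls_const] realize.unital_hom_axioms)

lemma unital_hom_laurent: "unital_hom laurent"
  unfolding laurent_def
  by (intro unital_hom_comp[OF unital_hom_poly] unital_hom.map_poly_hom unital_hom_const_realize)

interpretation laurent: unital_hom laurent by (rule unital_hom_laurent)

lemma laurent_monom: "laurent (monom c n) = fls_const (realize c) * fls_X_inv ^ n"
  by (simp add: laurent_def map_poly_monom poly_monom)

lemma laurent_const: "laurent [:c:] = fls_const (realize c)"
  using laurent_monom[of c 0] by (simp add: monom_0)

lemma laurent_altdef: "laurent f = (\<Sum>i\<le>degree f. fls_const (realize (coeff f i)) * fls_X_inv ^ i)"
  by (subst poly_as_sum_of_monoms[of f, symmetric]) (simp only: laurent.hom_sum laurent_monom)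

text \<open>Both sides are homomorphisms of the expansion of F, so it is enough to compare them on
  constants and on each p_k.\<close>

lemma pleth_shift:
  "pleth F (fls_const XX + fls_const (mps_const (MM * brk qq (int u))) * fls_X_inv)
    = laurent (shift_hom u (ps_expansion F))"
proof -
  let ?E = "fls_const XX + fls_const (mps_const (MM * brk qq (int u))) * fls_X_inv"
  have hom: "unital_hom (\<lambda>c. fls_const (mps_const c) :: Qq mps fls)"
    by (intro unital_hom_comp[OF unital_hom_fls_const] mps_const.unital_hom_axioms)
  show ?thesis
    unfolding pleth_def
  proof (rule hom_eqI[where f = "ps_subst (\<lambda>c. fls_const (mps_const c)) (\<lambda>k. pk k ?E)"
        and g = "\<lambda>P. laurent (shift_hom u P)"])
    show "unital_hom (\<lambda>P. laurent (shift_hom u P))"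
      by (intro unital_hom_comp[OF unital_hom_laurent] shift_hom.unital_hom_axioms)
    show "ps_subst (\<lambda>c. fls_const (mps_const c)) (\<lambda>k. pk k ?E) (ps_gen k) = laurent (shift_hom u (ps_gen k))"
      if "0 < k" for k
      using that by (simp add: ps_subst_gen[OF hom] shift_hom_gen laurent_monom laurent_const pk_shift pk_q_shift
          del: mps_const.hom_mult)
  qed (simp_all add: unital_hom_ps_subst[OF hom] ps_subst_const[OF hom] laurent_const)
qed

lemma pk_exp_nth:
  assumes k: "0 < k"
  shows "pk k (- (fls_X * fls_const (mps_const (brk tt (int u))) * fls_const XX)) $$ int n
    = (if n = k then mps_const (exp_coeff u k) * psum k else 0)"
proof -
  let ?E = "- (fls_X * fls_const (mps_const (brk tt (int u))) * fls_const XX)"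
  have E: "?E $$ i = (if i = 1 then mps_const (- brk tt (int u)) * XX else 0)" for i
    by (simp add: mult.assoc fls_const_mult_const)
  show ?thesis
  proof (cases "n = k")
    case True
    have "pk k ?E $$ int n = pk_mps k (mps_const (- brk tt (int u)) * XX)"
      using k unfolding pk_nth[OF k] fls_nth_compose_power[OF k] E by (simp add: True)
    also have "\<dots> = mps_const (exp_coeff u k) * psum k"
      unfolding pk_mps_const_times[OF k] pk_q_exp[OF k] ..
    finally show ?thesis using True by simp
  next
    case False
    have "fls_compose_power ?E k $$ int n = 0"
      using dvd_div_eq_iff[OF k, of "int n" 1] False unfolding fls_nth_compose_power[OF k] E by auto
    thus ?thesis using k False by (simp add: pk_nth)
  qed
qed

lemma fps_map_compose:
  assumes "unital_hom f"
  shows "fps_map f (A oo B) = fps_map f A oo fps_map f B"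
proof (rule fps_ext)
  interpret unital_hom f by fact
  interpret map: unital_hom "fps_map f" by (rule fps_map_hom)
  show "fps_map f (A oo B) $ n = (fps_map f A oo fps_map f B) $ n" for n
    by (simp add: fps_compose_nth flip: map.hom_power)
qed

lemma Omega_eq_omega_series:
  "Omega (- (fls_X * fls_const (mps_const (brk tt (int u))) * fls_const XX))
    = fps_to_fls (fps_map realize (omega_series u))"
proof -
  let ?E = "- (fls_X * fls_const (mps_const (brk tt (int u))) * fls_const XX)"
  have "Abs_fps (\<lambda>n. \<Sum>k=1..n. mps_const (1 / of_nat k) * pk k ?E $$ int n)
    = fps_map realize (Abs_fps (\<lambda>k. if k = 0 then 0 else ps_const (exp_coeff u k / of_nat k) * ps_gen k))"
  proof (rule fps_ext)
    fix n
    \<comment> \<open>E is a multiple of z, so p_k[E] is concentrated in degree k and only k = n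
      survives; for n = 0 the range is empty.\<close>
    have "(\<Sum>k=1..n. mps_const (1 / of_nat k) * pk k ?E $$ int n)
      = (\<Sum>k=1..n. if n = k then mps_const (1 / of_nat k) * (mps_const (exp_coeff u k) * psum k) else 0)"
      by (rule sum.cong) (simp_all add: pk_exp_nth)
    also have "\<dots> = (if n = 0 then 0 else mps_const (exp_coeff u n / of_nat n) * psum n)"
      by (auto simp flip: mult.assoc mps_const.hom_mult)
    finally show "Abs_fps (\<lambda>n. \<Sum>k=1..n. mps_const (1 / of_nat k) * pk k ?E $$ int n) $ n
      = fps_map realize (Abs_fps (\<lambda>k. if k = 0 then 0 else ps_const (exp_coeff u k / of_nat k) * ps_gen k)) $ n"
      by simp
  qed
  moreover have "Abs_fps (\<lambda>j. mps_const (1 / fact j)) = fps_map realize (Abs_fps (\<lambda>j. ps_const (1 / fact j)))"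
    by (rule fps_ext) simp
  ultimately show ?thesis
    unfolding Omega_def omega_series_def fps_map_compose[OF realize.unital_hom_axioms] by simp
qed

lemma D_op_eq: "D_op (int u) (int v) F = realize (D_poly u v (ps_expansion F))"
proof -
  define f where "f = shift_hom u (ps_expansion F)"
  have "D_op (int u) (int v) F
    = (\<Sum>i\<le>degree f. (fls_const (realize (coeff f i)) * (fls_X_inv ^ i * fps_to_fls (fps_map realize (omega_series u)))) $$ int v)"
    unfolding D_op_def pleth_shift Omega_eq_omega_series f_def[symmetric] laurent_altdef sum_distrib_right
    by (simp only: mult.assoc fls_nth_sum)
  also have "\<dots> = (\<Sum>i\<le>degree f. realize (coeff f i) * realize (omega_series u $ (v + i)))"
    by (simp add: fls_X_inv_power_times_conv_shift nat_int_add)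
  also have "\<dots> = realize (D_poly u v (ps_expansion F))"
    by (simp add: D_poly_def diag_coeff_def f_def)
  finally show ?thesis .
qed

section \<open>Commutators of scalar multiples of D\<close>

lemma D_poly_const_mult: "D_poly u v (ps_const c * P) = ps_const c * D_poly u v P"
  using diag_coeff_monom_mult[of "omega_series u" v "ps_const c" 0 "shift_hom u P"] by (simp add: D_poly_def monom_0)

text \<open>The value is always of the form \<open>realize P\<close>, so a second operator of this
  shape recovers P by \<open>ps_expansion_realize\<close>, and composites reduce to composites of
  \<open>D_poly\<close>.\<close>

definition scaled_D :: "Qq \<Rightarrow> nat \<Rightarrow> nat \<Rightarrow> Qq mps \<Rightarrow> Qq mps" where
  "scaled_D c u v F = realize (ps_const c * D_poly u v (ps_expansion F))"

lemma scaled_D_eq: "scaled_D c u v F = mps_const c * D_op (int u) (int v) F"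
  by (simp add: scaled_D_def D_op_eq)

text \<open>Here k is the determinant u2 v1 - u1 v2, so q^(u1 v2) - q^(u2 v1) = q^(u1 v2) (1 - q^k)
  contributes the bracket [k]. The extra factor q comes from 1/M = -q/(1 - q)^2.\<close>

lemma scaled_commutator_scaled_D:
  assumes "0 < u1" "0 < u2" "u2 * v1 = u1 * v2 + k"
  shows "scaled_commutator (scaled_D c1 u1 v1) (scaled_D c2 u2 v2) =
    scaled_D (c1 * c2 * qq ^ (u1 * v2 + 1) * brk qq (int u1) * brk qq (int u2) * brk qq (int k)
      / brk qq (int (u1 + u2))) (u1 + u2) (v1 + v2)" (is "_ = scaled_D ?c _ _")
proof
  fix F
  define P where "P = ps_expansion F"
  have nz: "1 - qq \<noteq> 0" "1 - qq ^ (u1 + u2) \<noteq> 0"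
    using qq_gt_1 qq_power_neq_1[of "u1 + u2"] assms by auto
  have MM: "1 / MM = - (qq / ((1 - qq) * (1 - qq)))"
    using nz by (simp add: MM_def tt_def divide_simps) (simp add: algebra_simps)
  have "- (q / (r * r)) * (c1 * c2 * (- (p1 * p2 / S) * (w * y)))
      = c1 * c2 * (w * q) * (p1 / r) * (p2 / r) * (y / r) / (S / r)"
    if "r \<noteq> 0" "S \<noteq> 0" for q r p1 p2 S w y :: Qq
    using that by (simp add: field_simps)
  note frac = this[OF nz, of qq "1 - qq ^ u1" "1 - qq ^ u2" "qq ^ (u1 * v2)" "1 - qq ^ k"]
  have w: "qq ^ (u1 * v2) - qq ^ (u1 * v2 + k) = qq ^ (u1 * v2) * (1 - qq ^ k)"
    by (simp add: power_add algebra_simps)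
  have c: "1 / MM * (c1 * c2 * (cross_factor u1 u2 * (qq ^ (u1 * v2) - qq ^ (u2 * v1)))) = ?c"
    unfolding assms(3) brk_int cross_factor_def MM w frac power_add[of _ "u1 * v2" 1] power_one_right ..
  have "scaled_commutator (scaled_D c1 u1 v1) (scaled_D c2 u2 v2) F
    = realize (ps_const (1 / MM) * (ps_const c1 * (ps_const c2 * D_poly u1 v1 (D_poly u2 v2 P))
        - ps_const c2 * (ps_const c1 * D_poly u2 v2 (D_poly u1 v1 P))))"
    unfolding scaled_commutator_def scaled_D_def ps_expansion_realize D_poly_const_mult P_def
    by (simp only: realize.hom_mult realize.hom_diff realize_const)
  also have "ps_const (1 / MM) * (ps_const c1 * (ps_const c2 * D_poly u1 v1 (D_poly u2 v2 P))
        - ps_const c2 * (ps_const c1 * D_poly u2 v2 (D_poly u1 v1 P)))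
      = ps_const (1 / MM) * (ps_const c1 * (ps_const c2 * (D_poly u1 v1 (D_poly u2 v2 P) - D_poly u2 v2 (D_poly u1 v1 P))))"
    by (simp add: right_diff_distrib mult.left_commute)
  also have "\<dots> = ps_const (1 / MM * (c1 * c2 * (cross_factor u1 u2 * (qq ^ (u1 * v2) - qq ^ (u2 * v1)))))
      * D_poly (u1 + u2) (v1 + v2) P"
    unfolding D_poly_commutator[OF assms(1,2)] by (simp only: ps_const.hom_mult mult.assoc)
  finally show "scaled_commutator (scaled_D c1 u1 v1) (scaled_D c2 u2 v2) F = scaled_D ?c (u1 + u2) (v1 + v2) F"
    unfolding c P_def scaled_D_def[symmetric] .
qed

section \<open>Lattice points and the recursion for Q\<close>

lemma brk_neq_0: "0 < u \<Longrightarrow> brk qq (int u) \<noteq> 0"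
  using qq_gt_1 qq_power_neq_1[of u] by (auto simp: brk_int)

text \<open>The factor that the theorem predicts for k = 1, since (m-1)n - (m-1)(n-1)/2 =
  (m-1)(n+1)/2.\<close>

definition Q_scalar :: "nat \<Rightarrow> nat \<Rightarrow> Qq" where
  "Q_scalar m n = qq ^ ((m - 1) * (n + 1) div 2) / brk qq (int m)"

lemma even_pred_mult_Suc:
  fixes m n :: nat
  assumes "coprime m n" "0 < m"
  shows "even ((m - 1) * (n + 1))"
proof -
  have "odd m \<or> odd n"
    using assms(1) by (meson coprime_common_divisor_nat coprime_def odd_one)
  thus ?thesis using assms(2) by (auto elim!: oddE)
qed

text \<open>The complementary point (a', b') = (km - a, kn - b) satisfies the mirrored relation m b'
  - n a' = 1, so both points are coprime. Their determinant is k (n a - m b) = k.\<close>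

lemma closest_below_bounds:
  assumes "(a, b) \<in> closest_below k m n" "0 < m" "1 \<le> k"
  shows "1 \<le> a" "a < k * m" "b < k * n" "n * a = m * b + 1"
    "coprime a b" "coprime (k * m - a) (k * n - b)"
    "a * (k * n - b) = (k * m - a) * b + k"
proof -
  show a: "1 \<le> a" "a < k * m" and eq: "n * a = m * b + 1"
    using assms by (auto simp: closest_below_def)
  have n: "0 < n" using eq by (intro gr0I) simp
  have "m * b < n * a" using eq by simp
  also have "\<dots> < n * (k * m)" using a n by simp
  finally have "m * b < m * (k * n)" by (simp add: mult_ac)
  thus b: "b < k * n" by simp
  show "coprime a b"
  proof (rule coprimeI)
    fix d assume "d dvd a" "d dvd b"
    hence "d dvd m * b + 1" "d dvd m * b" unfolding eq[symmetric] by auto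
    thus "is_unit d" by (metis dvd_add_right_iff)
  qed
  obtain a' b' where a': "k * m = a + a'" and b': "k * n = b + b'"
    using a b by (metis less_imp_add_positive)
  have "n * (a + a') = m * (b + b')" by (simp flip: a' b' add: mult_ac)
  hence eq': "m * b' = n * a' + 1" using eq by (simp add: distrib_left)
  show "coprime (k * m - a) (k * n - b)"
  proof (rule coprimeI)
    fix d assume "d dvd k * m - a" "d dvd k * n - b"
    hence "d dvd a'" "d dvd b'" by (simp_all add: a' b')
    hence "d dvd n * a' + 1" "d dvd n * a'" unfolding eq'[symmetric] by auto
    thus "is_unit d" by (metis dvd_add_right_iff)
  qed
  have "a * (b + b') = (a + a') * b + k"
  proof -
    have "a * (b + b') = k * (n * a)" by (simp flip: b')
    also have "\<dots> = (a + a') * b + k" unfolding eq by (simp flip: a' add: algebra_simps)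
    finally show ?thesis .
  qed
  thus "a * (k * n - b) = (k * m - a) * b + k"
    by (simp add: a' b' distrib_left distrib_right)
qed

text \<open>The brackets of the two smaller operators cancel against the denominators of their
  \<open>Q_scalar\<close>, leaving [k]/[km] and a power of q. Its exponent is described by an
  equation rather than a quotient, to avoid halving.\<close>

lemma commutator_step:
  assumes ab: "(a, b) \<in> closest_below k m n" "0 < m" "1 \<le> k"
  shows "\<exists>e. 2 * e + (k - 1) = (k * m - 1) * (k * n + 1) \<and>
    scaled_commutator (scaled_D (Q_scalar (k * m - a) (k * n - b)) (k * m - a) (k * n - b))
      (scaled_D (Q_scalar a b) a b) =
    scaled_D (qq ^ e * (brk qq (int k) / brk qq (int (k * m)))) (k * m) (k * n)"
proof -
  note bnd = closest_below_bounds[OF assms]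
  obtain c where c: "k * m = c + a" "0 < c" "k * m - a = c"
    using bnd(2) by (metis add.commute add_diff_cancel_left' less_imp_add_positive)
  obtain d where d: "k * n = d + b" "k * n - b = d"
    using bnd(3) by (metis add.commute add_diff_cancel_left' less_imp_add_positive)
  have cop: "coprime c d" "coprime a b" and det: "a * d = c * b + k"
    using bnd c d by simp_all
  obtain x where x: "(c - 1) * (d + 1) = 2 * x"
    using even_pred_mult_Suc[OF cop(1) c(2)] by (elim evenE)
  have "0 < a" using bnd(1) by simp
  then obtain y where y: "(a - 1) * (b + 1) = 2 * y"
    using even_pred_mult_Suc[OF cop(2)] by (meson evenE)
  define e where "e = x + y + (c * b + 1)"
  \<comment> \<open>Predecessors remove truncated subtraction. The identity needed is (c-1)(d+1) +
    (a-1)(b+1) + 2cb + k + 1 = (c+a-1)(d+b+1), which holds because ad = cb + k.\<close>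
  obtain a' c' k' where pred: "a = Suc a'" "c = Suc c'" "k = Suc k'"
    using bnd(1) c(2) assms(3) by (metis Suc_le_D One_nat_def Suc_leI)
  have e: "2 * e + (k - 1) = (k * m - 1) * (k * n + 1)"
    unfolding c(1) d(1) e_def using x y det by (simp add: pred algebra_simps)
  have "scaled_commutator (scaled_D (Q_scalar c d) c d) (scaled_D (Q_scalar a b) a b) =
     scaled_D (Q_scalar c d * Q_scalar a b * qq ^ (c * b + 1) * brk qq (int c) * brk qq (int a) * brk qq (int k)
      / brk qq (int (c + a))) (c + a) (d + b)"
    using det bnd(1) c(2) by (intro scaled_commutator_scaled_D) auto
  also have "Q_scalar c d * Q_scalar a b * qq ^ (c * b + 1) * brk qq (int c) * brk qq (int a) * brk qq (int k)
      / brk qq (int (c + a)) = qq ^ e * (brk qq (int k) / brk qq (int (c + a)))"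
    using brk_neq_0[of a] brk_neq_0[of c] bnd(1) c(2)
    by (simp add: Q_scalar_def x[simplified] y[simplified] e_def power_add)
  finally show ?thesis using e unfolding c(3) d(2) c(1)[symmetric] d(1)[symmetric] by blast
qed

text \<open>The induction must admit n = 0, since the split point can be (1, 0).\<close>

lemma Q_coprime_eq:
  assumes "coprime m n" "0 < m"
  shows "Q_coprime m n = scaled_D (Q_scalar m n) m n"
  using assms
proof (induction m arbitrary: n rule: less_induct)
  case (less m)
  show ?case
  proof (cases "m = 1")
    case True
    have "brk qq 1 = 1" using qq_gt_1 by (simp add: brk_def)
    thus ?thesis
      using D_op_eq[of 1 n] True by (auto simp: fun_eq_iff scaled_D_eq Q_scalar_def Q_coprime.simps)
  next
    case False
    hence m: "2 \<le> m" using less.prems by simp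
    obtain a b where ab: "split_point m n = (a, b)" by (cases "split_point m n")
    have mem: "(a, b) \<in> closest_below 1 m n"
      using split_point_mem[OF less.prems(1) m] ab by simp
    note bnd = closest_below_bounds[OF mem less.prems(2) order_refl, simplified]
    have "Q_coprime m n = scaled_commutator (Q_coprime (m - a) (n - b)) (Q_coprime a b)"
      using False m less.prems ab by (subst Q_coprime.simps) simp
    also have "\<dots> = scaled_commutator (scaled_D (Q_scalar (m - a) (n - b)) (m - a) (n - b)) (scaled_D (Q_scalar a b) a b)"
      using less.IH[of a b] less.IH[of "m - a" "n - b"] bnd by simp
    finally have *: "Q_coprime m n = scaled_commutator
        (scaled_D (Q_scalar (m - a) (n - b)) (m - a) (n - b)) (scaled_D (Q_scalar a b) a b)" .
    obtain e where e: "2 * e = (m - 1) * (n + 1)"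
      "Q_coprime m n = scaled_D (qq ^ e * (brk qq 1 / brk qq (int m))) m n"
      using commutator_step[OF mem less.prems(2) order_refl] unfolding * by auto
    have "brk qq 1 = 1" using qq_gt_1 by (simp add: brk_def)
    thus ?thesis unfolding e(2) Q_scalar_def e(1)[symmetric] by simp
  qed
qed

text \<open>The equation determines e from k, m and n, so the right-hand side does not depend on (a,
  b): all admissible choices give the same operator.\<close>

lemma Q_ops_eq:
  assumes "coprime m n" "0 < m" "1 \<le> k" "Q \<in> Q_ops k m n"
  shows "\<exists>e. 2 * e + (k - 1) = (k * m - 1) * (k * n + 1) \<and>
    Q = scaled_D (qq ^ e * (brk qq (int k) / brk qq (int (k * m)))) (k * m) (k * n)"
proof (cases "k = 1")
  case True
  have "brk qq 1 = 1" using qq_gt_1 by (simp add: brk_def)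
  thus ?thesis
    using assms True even_pred_mult_Suc[OF assms(1,2)]
    by (intro exI[of _ "(m - 1) * (n + 1) div 2"]) (simp add: Q_ops_def Q_coprime_eq Q_scalar_def)
next
  case False
  then obtain a b where ab: "(a, b) \<in> closest_below k m n"
      and Q: "Q = scaled_commutator (Q_coprime (k * m - a) (k * n - b)) (Q_coprime a b)"
    using assms(4) by (auto simp: Q_ops_def)
  note bnd = closest_below_bounds[OF ab assms(2,3)]
  have "Q = scaled_commutator (scaled_D (Q_scalar (k * m - a) (k * n - b)) (k * m - a) (k * n - b))
      (scaled_D (Q_scalar a b) a b)"
    using bnd by (simp add: Q Q_coprime_eq)
  thus ?thesis using commutator_step[OF ab assms(2,3)] by simp
qed

theorem theoremI2:
  fixes k m n :: nat and Q :: "Qq mps \<Rightarrow> Qq mps" and F :: "Qq mps"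
  assumes "coprime m n" and "0 < m" and "0 < n" and "1 \<le> k"
    and "Q \<in> Q_ops k m n"
    and "F \<in> sym_funs"
  shows "mps_const (qq ^ (((k * m - 1) * (k * n - 1) + (k - 1)) div 2)) * Q F =
         mps_const (qq ^ ((k * m - 1) * (k * n)) * (brk qq (int k) / brk qq (int (k * m))))
           * D_op (int (k * m)) (int (k * n)) F"
proof -
  obtain e where e: "2 * e + (k - 1) = (k * m - 1) * (k * n + 1)"
    and Q: "Q = scaled_D (qq ^ e * (brk qq (int k) / brk qq (int (k * m)))) (k * m) (k * n)"
    using Q_ops_eq[OF assms(1,2,4,5)] by blast
  define x where "x = ((k * m - 1) * (k * n - 1) + (k - 1)) div 2"
  have x: "2 * x = (k * m - 1) * (k * n - 1) + (k - 1)"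
    unfolding x_def using even_exponent[OF assms(1-4)] by simp
  obtain j l where j: "k * m = Suc j" and l: "k * n = Suc l"
    using assms(2-4) by (cases "k * m"; cases "k * n") auto
  \<comment> \<open>The term k - 1 enters the equations for x and e on opposite sides and drops out
    of the sum.\<close>
  have "2 * (x + e) = (k * m - 1) * (k * n - 1) + (k * m - 1) * (k * n + 1)"
    using x e by simp
  also have "\<dots> = 2 * ((k * m - 1) * (k * n))"
    unfolding l j by (simp add: algebra_simps)
  finally have "x + e = (k * m - 1) * (k * n)" by simp
  hence *: "qq ^ x * (qq ^ e * (brk qq (int k) / brk qq (int (k * m))))
      = qq ^ ((k * m - 1) * (k * n)) * (brk qq (int k) / brk qq (int (k * m)))"
    by (simp flip: mult.assoc power_add)
  show ?thesis
    unfolding x_def[symmetric] Q scaled_D_eq *[symmetric] by (simp only: mps_const.hom_mult mult.assoc)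
qed

end
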